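(* Let $\Delta$ be a simplicial complex of rank $r$ on a finite ground set $E$, equipped with a surjective finite abelian group structure $\mathcal G$, and let $P=\mathrm{ind}(E,\Delta,\mathcal G)$ with $f$-vector $(f_0,\dots,f_r)$ and $h$-vector $(h_0,\dots,h_r)$. If $\mathcal G$ is torsion-free, i.e. $\mathcal G(\emptyset)\cong\{0\}$, then the Stanley--Reisner ring $\mathbb K[P]$ (with the grading $\deg y=\rho(y)$) satisfies $$\mathrm{Hilb}(\mathbb K[P],t)=\frac{h_0+h_1t+\dots+h_rt^r}{(1-t)^r}.$$ In general, letting $\tilde P=\mathrm{ind}(E,\Delta,\tilde{\mathcal G})$ be the independence poset of the associated torsion-free structure $\tilde{\mathcal G}$, the Stanley--Reisner ring $\mathbb K[\tilde P]$ satisfies $$\mathrm{Hilb}(\mathbb K[\tilde P],t)=\frac{1}{|\mathcal G(\emptyset)|}\cdot\frac{h_0+h_1t+\dots+h_rt^r}{(1-t)^r},$$ where $(h_0,\dots,h_r)$ is the $h$-vector of $P$.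
   Context: $\mathbb K$ is a fixed field. A simplicial complex $\Delta$ on $E$ has rank $r$ if $r$ is the maximal cardinality of a face. A surjective finite abelian group structure $\mathcal G$ on $\Delta$ assigns to each $S\in\Delta$ a finite abelian group $\mathcal G(S)$, and to each $S\in\Delta$, $a\in E\setminus S$ with $S\cup\{a\}\in\Delta$ a surjective homomorphism $\pi_{S,a}:\mathcal G(S\cup\{a\})\to\mathcal G(S)$, such that $\pi_{S,a}\circ\pi_{S\cup\{a\},b}=\pi_{S,b}\circ\pi_{S\cup\{b\},a}$ whenever $a\neq b$, $a,b\notin S$, $S\cup\{a,b\}\in\Delta$. It is torsion-free if $|\mathcal G(\emptyset)|=1$. For $S=\{s_1,\dots,s_k\}\in\Delta$ let $\pi_S:\mathcal G(S)\to\mathcal G(\emptyset)$ be the composite $\pi_{\emptyset,s_1}\circ\pi_{\{s_1\},s_2}\circ\dots\circ\pi_{\{s_1,\dots,s_{k-1}\},s_k}$ (independent of the ordering). The associated torsion-free structure is $\tilde{\mathcal G}(S):=\ker\pi_S=\{h\in\mathcal G(S):\pi_S(h)=0\}$ with maps the restrictions of $\pi_{S,a}$. The independence poset $\mathrm{ind}(E,\Delta,\mathcal G)$ has elements $(S,g)$, $S\in\Delta$, $g\in\mathcal G(S)$, with order generated by: $(S\cup\{a\},g)$ covers $(S,h)$ iff $a\notin S$, $S\cup\{a\}\in\Delta$ and $\pi_{S,a}(g)=h$. Its rank function is $\rho((S,g))=|S|$; $f_i$ is the number of elements of rank $i$, $f_P(t)=\sum_{i=0}^r f_it^{r-i}$,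 and the $h$-vector is defined by $f_P(t-1)=\sum_{i=0}^r h_it^{r-i}$. For a simplicial poset $Q$ (finite poset with unique minimum $\hat 0$ such that every $[\hat 0,y]$ is Boolean) with elements $\hat 0=y_0,y_1,\dots,y_p$, the Stanley--Reisner ring is $\mathbb K[Q]=\mathbb K[y_0,\dots,y_p]/I_Q$, where $I_Q$ is generated by: $y_iy_j$ if $y_i,y_j$ have no common upper bound; $y_iy_j-(y_i\wedge y_j)\sum_z z$, the sum over all minimal upper bounds $z$ of $y_i,y_j$, otherwise; and $y_0-1$. It is graded by $\deg y_i=\rho(y_i)$, the rank of $[\hat 0,y_i]$, and $\mathrm{Hilb}$ denotes its Hilbert series. *)

theory Defs
  imports
    "HOL-Library.Poly_Mapping"
    "HOL-Computational_Algebra.Polynomial"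
    "HOL-Computational_Algebra.Formal_Power_Series"
    "HOL-Algebra.Lattice"
    "HOL-Algebra.QuotRing"
    "HOL-Algebra.Embedded_Algebras"
    "HOL-Algebra.Elementary_Groups"
begin

section \<open>Finite abelian group structures on simplicial complexes\<close>

text \<open>Elements of the ground set \<^term>\<open>E\<close> need not be vertices of the complex.\<close>

locale abstract_complex =
  fixes E :: "'e set" and \<Delta> :: "'e set set"
  assumes faces_subset: "\<Delta> \<subseteq> Pow E"
    and empty_face: "{} \<in> \<Delta>"
    and subface: "\<lbrakk>T \<in> \<Delta>; S \<subseteq> T\<rbrakk> \<Longrightarrow> S \<in> \<Delta>"

definition complex_rank :: "'e set set \<Rightarrow> nat" where
  "complex_rank \<Delta> = Max (card ` \<Delta>)"

text \<open>The groups are written multiplicatively, as usual in HOL-Algebra; \<^term>\<open>\<pi> S a\<close> is the map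
  from the group at \<^term>\<open>insert a S\<close> to the group at \<^term>\<open>S\<close>.\<close>

locale surjective_group_structure = abstract_complex E \<Delta>
  for E :: "'e set" and \<Delta> :: "'e set set" +
  fixes G :: "'e set \<Rightarrow> 'g monoid" and \<pi> :: "'e set \<Rightarrow> 'e \<Rightarrow> 'g \<Rightarrow> 'g"
  assumes abelian: "S \<in> \<Delta> \<Longrightarrow> comm_group (G S)"
    and finite_group: "S \<in> \<Delta> \<Longrightarrow> finite (carrier (G S))"
    and proj_epi: "\<lbrakk>S \<in> \<Delta>; a \<in> E - S; insert a S \<in> \<Delta>\<rbrakk> \<Longrightarrow> \<pi> S a \<in> epi (G (insert a S)) (G S)"
    and proj_commute: "\<lbrakk>a \<noteq> b; a \<notin> S; b \<notin> S; insert a (insert b S) \<in> \<Delta>;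
        g \<in> carrier (G (insert a (insert b S)))\<rbrakk>
      \<Longrightarrow> \<pi> S a (\<pi> (insert a S) b g) = \<pi> S b (\<pi> (insert b S) a g)"

definition torsion_free :: "('e set \<Rightarrow> 'g monoid) \<Rightarrow> bool" where
  "torsion_free G \<longleftrightarrow> card (carrier (G {})) = 1"

fun iter_proj :: "('e set \<Rightarrow> 'e \<Rightarrow> 'g \<Rightarrow> 'g) \<Rightarrow> 'e set \<Rightarrow> 'e list \<Rightarrow> 'g \<Rightarrow> 'g" where
  "iter_proj \<pi> S [] = (\<lambda>g. g)"
| "iter_proj \<pi> S (s # ss) = \<pi> S s \<circ> iter_proj \<pi> (insert s S) ss"

text \<open>The map from the group at \<^term>\<open>S\<close> to the group at the empty face. The choice of the
  enumeration is immaterial, see \<open>proj_to_empty_eq\<close> below.\<close>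

definition proj_to_empty :: "('e set \<Rightarrow> 'e \<Rightarrow> 'g \<Rightarrow> 'g) \<Rightarrow> 'e set \<Rightarrow> 'g \<Rightarrow> 'g" where
  "proj_to_empty \<pi> S = iter_proj \<pi> {} (SOME ss. distinct ss \<and> set ss = S)"

definition torsion_free_part ::
  "('e set \<Rightarrow> 'g monoid) \<Rightarrow> ('e set \<Rightarrow> 'e \<Rightarrow> 'g \<Rightarrow> 'g) \<Rightarrow> 'e set \<Rightarrow> 'g monoid" where
  "torsion_free_part G \<pi> S = (G S)\<lparr>carrier := kernel (G S) (G {}) (proj_to_empty \<pi> S)\<rparr>"

context surjective_group_structure
begin

lemma proj_closed:
  assumes "insert a S \<in> \<Delta>" "a \<notin> S" "g \<in> carrier (G (insert a S))"
  shows "\<pi> S a g \<in> carrier (G S)"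
proof -
  have "S \<in> \<Delta>" "a \<in> E - S"
    using assms(1,2) subface[of "insert a S" S] faces_subset by auto
  from proj_epi[OF this assms(1)] assms(3) show ?thesis
    by (auto simp: epi_def hom_def)
qed

lemma iter_proj_closed:
  assumes "B \<union> set ss \<in> \<Delta>" "B \<inter> set ss = {}" "distinct ss" "g \<in> carrier (G (B \<union> set ss))"
  shows "iter_proj \<pi> B ss g \<in> carrier (G B)"
  using assms
proof (induction ss arbitrary: B)
  case (Cons s ss)
  have "iter_proj \<pi> (insert s B) ss g \<in> carrier (G (insert s B))"
    using Cons.prems by (intro Cons.IH) auto
  moreover have "insert s B \<in> \<Delta>"
    by (rule subface[OF Cons.prems(1)]) auto
  ultimately show ?case
    using Cons.prems proj_closed[of s B] by auto
qed simp

lemma iter_proj_permute: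
  assumes "B \<union> set ss \<in> \<Delta>" "B \<inter> set ss = {}" "distinct ss" "distinct ts" "set ts = set ss"
    "g \<in> carrier (G (B \<union> set ss))"
  shows "iter_proj \<pi> B ss g = iter_proj \<pi> B ts g"
  using assms
proof (induction "length ss" arbitrary: B ss ts)
  case (Suc n)
  then obtain s ss' where ss: "ss = s # ss'" by (cases ss) auto
  with Suc.prems obtain t ts' where ts: "ts = t # ts'" by (cases ts) auto
  show ?case
  proof (cases "s = t")
    case True
    have "set ts' = set ss'"
      using Suc.prems(3-5) by (auto simp: ss ts True)
    then have "iter_proj \<pi> (insert s B) ss' g = iter_proj \<pi> (insert s B) ts' g"
      using Suc.prems Suc.hyps(2) by (intro Suc.hyps(1)) (auto simp: ss ts)
    then show ?thesis by (simp add: ss ts True)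
  next
    case False
    obtain zs where zs: "set zs = set ss - {s, t}" "distinct zs"
      using finite_distinct_list[of "set ss - {s, t}"] by auto
    have t: "t \<in> set ss" "t \<in> set ss'" using Suc.prems(5) False by (auto simp: ss ts)
    have len: "length ts' = n" "length ss' = n"
      using Suc.prems(3-5) Suc.hyps(2) distinct_card[of ss] distinct_card[of ts]
      by (auto simp: ss ts)
    have sets: "set (t # zs) = set ss'" "set (s # zs) = set ts'"
      "insert s B \<union> set ss' = B \<union> set ss" "insert t B \<union> set ts' = B \<union> set ss"
      "insert t (insert s B) \<union> set zs = B \<union> set ss"
      using Suc.prems(3-5) zs(1) t False by (auto simp: ss ts)
    have 1: "iter_proj \<pi> (insert s B) ss' g = iter_proj \<pi> (insert s B) (t # zs) g"
      by (rule Suc.hyps(1)) (use Suc.prems zs t False len in \<open>auto simp: ss sets\<close>)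
    have 2: "iter_proj \<pi> (insert t B) ts' g = iter_proj \<pi> (insert t B) (s # zs) g"
    proof (rule Suc.hyps(1))
      show "insert t B \<union> set ts' \<in> \<Delta>" "g \<in> carrier (G (insert t B \<union> set ts'))"
        using Suc.prems by (simp_all only: sets)
      show "set (s # zs) = set ts'" by (rule sets(2))
    qed (use Suc.prems zs len in \<open>auto simp: ts\<close>)
    define w where "w = iter_proj \<pi> (insert t (insert s B)) zs g"
    have w: "w \<in> carrier (G (insert t (insert s B)))"
      unfolding w_def
    proof (rule iter_proj_closed)
      show "insert t (insert s B) \<union> set zs \<in> \<Delta>" "g \<in> carrier (G (insert t (insert s B) \<union> set zs))"
        using Suc.prems by (simp_all only: sets)
    qed (use Suc.prems zs t in auto)
    have "insert t (insert s B) \<in> \<Delta>"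
      by (rule subface[OF Suc.prems(1)]) (use t in \<open>auto simp: ss\<close>)
    then have "\<pi> B s (\<pi> (insert s B) t w) = \<pi> B t (\<pi> (insert t B) s w)"
      using proj_commute[of s t B w] False Suc.prems(2) t w by (auto simp: ss insert_commute)
    then show ?thesis
      using 1 2 by (simp add: ss ts w_def insert_commute)
  qed
qed simp

lemma proj_to_empty_eq:
  assumes "set ss \<in> \<Delta>" "distinct ss" "g \<in> carrier (G (set ss))"
  shows "proj_to_empty \<pi> (set ss) g = iter_proj \<pi> {} ss g"
proof -
  have "distinct (SOME ts. distinct ts \<and> set ts = set ss) \<and>
    set (SOME ts. distinct ts \<and> set ts = set ss) = set ss"
    by (rule someI[of _ ss]) (use assms(2) in simp)
  then show ?thesis
    unfolding proj_to_empty_def using assms by (intro iter_proj_permute[symmetric]) auto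
qed

end

section \<open>The independence poset and its h-vector\<close>

definition ind_covers ::
  "'e set set \<Rightarrow> ('e set \<Rightarrow> 'g monoid) \<Rightarrow> ('e set \<Rightarrow> 'e \<Rightarrow> 'g \<Rightarrow> 'g)
    \<Rightarrow> 'e set \<times> 'g \<Rightarrow> 'e set \<times> 'g \<Rightarrow> bool" where
  "ind_covers \<Delta> G \<pi> x y \<longleftrightarrow> (\<exists>S a h g. x = (S, h) \<and> y = (insert a S, g) \<and> a \<notin> S \<and> S \<in> \<Delta> \<and>
     insert a S \<in> \<Delta> \<and> h \<in> carrier (G S) \<and> g \<in> carrier (G (insert a S)) \<and> \<pi> S a g = h)"

definition ind_poset ::
  "'e set set \<Rightarrow> ('e set \<Rightarrow> 'g monoid) \<Rightarrow> ('e set \<Rightarrow> 'e \<Rightarrow> 'g \<Rightarrow> 'g) \<Rightarrow> ('e set \<times> 'g) gorder" where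
  "ind_poset \<Delta> G \<pi> =
     \<lparr>carrier = {(S, g). S \<in> \<Delta> \<and> g \<in> carrier (G S)}, eq = (=), le = (ind_covers \<Delta> G \<pi>)\<^sup>*\<^sup>*\<rparr>"

definition ind_rank :: "'e set \<times> 'g \<Rightarrow> nat" where
  "ind_rank x = card (fst x)"

definition f_vector :: "('e set \<times> 'g) gorder \<Rightarrow> nat \<Rightarrow> nat" where
  "f_vector P i = card {x \<in> carrier P. ind_rank x = i}"

definition f_poly :: "nat \<Rightarrow> ('e set \<times> 'g) gorder \<Rightarrow> int poly" where
  "f_poly r P = (\<Sum>i\<le>r. Polynomial.monom (int (f_vector P i)) (r - i))"

text \<open>The coefficients of \<open>f\<^sub>P(t - 1)\<close>, in decreasing order; meaningful for \<open>i \<le> r\<close> only.\<close>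

definition h_vector :: "nat \<Rightarrow> ('e set \<times> 'g) gorder \<Rightarrow> nat \<Rightarrow> int" where
  "h_vector r P i = Polynomial.coeff (pcompose (f_poly r P) [:- 1, 1:]) (r - i)"

section \<open>The Stanley--Reisner ring of a simplicial poset\<close>

text \<open>The polynomial ring over the field \<open>'k\<close> in the variables \<^term>\<open>V\<close>: a monomial is a finitely
  supported exponent function, a polynomial a finitely supported function on monomials.\<close>

definition mpoly_ring :: "'v set \<Rightarrow> (('v \<Rightarrow>\<^sub>0 nat) \<Rightarrow>\<^sub>0 'k::field) ring" where
  "mpoly_ring V = \<lparr>carrier = {p. \<forall>m \<in> Poly_Mapping.keys p. Poly_Mapping.keys m \<subseteq> V},
     mult = (*), one = 1, zero = 0, add = (+)\<rparr>"

definition mvar :: "'v \<Rightarrow> (('v \<Rightarrow>\<^sub>0 nat) \<Rightarrow>\<^sub>0 'k::field)" where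
  "mvar v = Poly_Mapping.single (Poly_Mapping.single v 1) 1"

definition mconst :: "'k \<Rightarrow> (('v \<Rightarrow>\<^sub>0 nat) \<Rightarrow>\<^sub>0 'k::field)" where
  "mconst c = Poly_Mapping.single 0 c"

lemma mpoly_ring_cring: "cring (mpoly_ring V :: (('v \<Rightarrow>\<^sub>0 nat) \<Rightarrow>\<^sub>0 'k::field) ring)"
proof -
  let ?R = "mpoly_ring V :: (('v \<Rightarrow>\<^sub>0 nat) \<Rightarrow>\<^sub>0 'k) ring"
  have add: "p + q \<in> carrier ?R" if "p \<in> carrier ?R" "q \<in> carrier ?R" for p q
    using that Poly_Mapping.keys_add[of p q] by (auto simp: mpoly_ring_def)
  have mult: "p * q \<in> carrier ?R" if pq: "p \<in> carrier ?R" "q \<in> carrier ?R" for p q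
  proof -
    have "Poly_Mapping.keys m \<subseteq> V" if m_in: "m \<in> Poly_Mapping.keys (p * q)" for m
    proof -
      have "m \<in> {a + b | a b. a \<in> Poly_Mapping.keys p \<and> b \<in> Poly_Mapping.keys q}"
        using m_in Poly_Mapping.keys_mult[of p q] by (rule rev_subsetD)
      then obtain a b where m: "m = a + b" "a \<in> Poly_Mapping.keys p" "b \<in> Poly_Mapping.keys q"
        by blast
      with pq have "Poly_Mapping.keys a \<union> Poly_Mapping.keys b \<subseteq> V"
        by (auto simp: mpoly_ring_def)
      then show ?thesis
        using Poly_Mapping.keys_add[of a b] by (auto simp: m)
    qed
    then show ?thesis by (simp add: mpoly_ring_def)
  qed
  have sel: "p \<oplus>\<^bsub>?R\<^esub> q = p + q" "p \<otimes>\<^bsub>?R\<^esub> q = p * q" "\<zero>\<^bsub>?R\<^esub> = 0" "\<one>\<^bsub>?R\<^esub> = 1" for p q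
    by (simp_all add: mpoly_ring_def)
  have carr: "0 \<in> carrier ?R" "1 \<in> carrier ?R" "p \<in> carrier ?R \<Longrightarrow> - p \<in> carrier ?R" for p
    by (simp_all add: mpoly_ring_def)
  have "\<exists>q \<in> carrier ?R. q + p = 0" if "p \<in> carrier ?R" for p
    using carr(3)[OF that] left_minus by blast
  then have "abelian_group ?R"
    by (intro abelian_groupI) (simp_all only: sel add carr ac_simps add_0_left add_0_right)
  moreover have "comm_monoid ?R"
    by (intro comm_monoidI) (simp_all only: sel mult carr ac_simps mult_1_left mult_1_right)
  ultimately show ?thesis
    by (rule cringI) (simp only: sel distrib_right)
qed

definition minimal_upper_bounds :: "'v gorder \<Rightarrow> 'v \<Rightarrow> 'v \<Rightarrow> 'v set" where
  "minimal_upper_bounds Q x y =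
     {z \<in> Upper Q {x, y}. \<forall>w \<in> Upper Q {x, y}. w \<sqsubseteq>\<^bsub>Q\<^esub> z \<longrightarrow> w = z}"

text \<open>In a simplicial poset, two elements with a common upper bound have a meet, so the meet below is
  only used where it exists.\<close>

definition SR_ideal :: "'v gorder \<Rightarrow> (('v \<Rightarrow>\<^sub>0 nat) \<Rightarrow>\<^sub>0 'k::field) set" where
  "SR_ideal Q = Idl\<^bsub>mpoly_ring (carrier Q)\<^esub>
     ({mvar x * mvar y | x y. x \<in> carrier Q \<and> y \<in> carrier Q \<and> Upper Q {x, y} = {}} \<union>
      {mvar x * mvar y - mvar (x \<sqinter>\<^bsub>Q\<^esub> y) * (\<Sum>z \<in> minimal_upper_bounds Q x y. mvar z) | x y.
         x \<in> carrier Q \<and> y \<in> carrier Q \<and> Upper Q {x, y} \<noteq> {}} \<union>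
      {mvar \<bottom>\<^bsub>Q\<^esub> - 1})"

definition SR_ring :: "'v gorder \<Rightarrow> (('v \<Rightarrow>\<^sub>0 nat) \<Rightarrow>\<^sub>0 'k::field) set ring" where
  "SR_ring Q = mpoly_ring (carrier Q) Quot SR_ideal Q"

text \<open>The rank of the interval from the minimum to \<^term>\<open>y\<close>, as the maximal length of a chain.\<close>

definition interval_rank :: "'v gorder \<Rightarrow> 'v \<Rightarrow> nat" where
  "interval_rank Q y = Max {card C - 1 | C. C \<subseteq> \<lbrace>\<bottom>\<^bsub>Q\<^esub>..y\<rbrace>\<^bsub>Q\<^esub> \<and> C \<noteq> {} \<and>
     (\<forall>u\<in>C. \<forall>v\<in>C. u \<sqsubseteq>\<^bsub>Q\<^esub> v \<or> v \<sqsubseteq>\<^bsub>Q\<^esub> u)}"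

definition monomial_degree :: "'v gorder \<Rightarrow> ('v \<Rightarrow>\<^sub>0 nat) \<Rightarrow> nat" where
  "monomial_degree Q m = (\<Sum>y \<in> Poly_Mapping.keys m. Poly_Mapping.lookup m y * interval_rank Q y)"

text \<open>The grading of the quotient ring is induced from the one of the polynomial ring: the component
  of degree \<^term>\<open>d\<close> consists of the classes of the homogeneous polynomials of degree \<^term>\<open>d\<close>.\<close>

definition SR_component :: "'v gorder \<Rightarrow> nat \<Rightarrow> (('v \<Rightarrow>\<^sub>0 nat) \<Rightarrow>\<^sub>0 'k::field) set set" where
  "SR_component Q d = (\<lambda>p. SR_ideal Q +>\<^bsub>mpoly_ring (carrier Q)\<^esub> p) `
     {p \<in> carrier (mpoly_ring (carrier Q)). \<forall>m \<in> Poly_Mapping.keys p. monomial_degree Q m = d}"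

text \<open>The copy of the field \<open>'k\<close> inside the Stanley--Reisner ring.\<close>

definition SR_scalars :: "'v gorder \<Rightarrow> (('v \<Rightarrow>\<^sub>0 nat) \<Rightarrow>\<^sub>0 'k::field) set set" where
  "SR_scalars Q = range (\<lambda>c. SR_ideal Q +>\<^bsub>mpoly_ring (carrier Q)\<^esub> mconst c)"

text \<open>The relation says that the Stanley--Reisner ring over \<open>'k\<close> has the Hilbert series \<^term>\<open>F\<close>: all
  its graded components are finite-dimensional, and \<^term>\<open>F\<close> is the generating function of their
  dimensions (unique, as \<^const>\<open>SR_scalars\<close> is a subfield). It is a relation instead of a
  function since \<^const>\<open>ring.dim\<close> has an arbitrary value on infinite-dimensional spaces.\<close>

definition has_SR_Hilbert_series :: "'k::field itself \<Rightarrow> 'v gorder \<Rightarrow> rat fps \<Rightarrow> bool" where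
  "has_SR_Hilbert_series K Q F \<longleftrightarrow> (\<forall>d. \<exists>n.
     ring.dimension (SR_ring Q :: (('v \<Rightarrow>\<^sub>0 nat) \<Rightarrow>\<^sub>0 'k) set ring) n (SR_scalars Q) (SR_component Q d) \<and>
     fps_nth F d = of_nat n)"

end

theory Submission
  imports Defs
begin

text \<open>The monomials supported on a chain of elements different from the minimum form a basis of the
  Stanley--Reisner ring. They span because the product of two incomparable elements can be replaced
  by their meet times the sum of their minimal upper bounds, which terminates by strict concavity of
  \<open>c \<mapsto> (B - c) c\<close>. They are independent because, for every \<open>y\<close>, sending \<open>x\<close> to the product of the
  atoms below \<open>x\<close> if \<open>x \<le> y\<close> and to 0 otherwise defines a ring homomorphism to a polynomial ring in
  the atoms below \<open>y\<close>, and the image of a chain monomial with top \<open>y\<close> determines it. The exponents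
  occurring in these images are all functions with full support on the atoms below \<open>y\<close>, so every
  element of rank \<open>i\<close> contributes \<open>(t / (1 - t))\<^sup>i\<close> to the Hilbert series.

  Passing to the torsion-free part divides all \<open>f\<^sub>i\<close> by the order of the group at the empty face, since
  the projections to that group are surjective.\<close>

section \<open>Weights and linear extensions of monomials\<close>

text \<open>In an independence poset several atoms can lie over the same ground element, so a pair
  can have several minimal upper bounds with the same labels, and labels alone do not separate chain
  monomials. Below a fixed element \<open>y\<close> this ambiguity disappears: a face of
  \<open>y\<close> is determined by its labels, at most one minimal upper bound of a given pair lies
  below \<open>y\<close>, and the defining relation becomes the multiset identity A + B = (A
  \<inter> B) + (A \<union> B). Independence is therefore tested one chain monomial at a time, below
  its own top.

  A linear function of the rank cannot serve as termination measure, since that identity keeps the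
  total rank constant. For ranks i + s and i + t with meet of rank i and minimal upper bound of rank
  i + s + t, the function c \<mapsto> (B - c) c loses exactly 2 s t, which is positive for an
  incomparable pair.

  The torsion-free part enters through the minimum: over the empty face its group is trivial, so
  there is a single minimal element. If the structure is already torsion-free, all kernels are the
  whole groups, and the first claim is a case of the second.\<close>

lemma keys_add_nat: "Poly_Mapping.keys (M + N) = Poly_Mapping.keys M \<union> Poly_Mapping.keys N"
  for M N :: "'v \<Rightarrow>\<^sub>0 nat"
  by (auto simp: in_keys_iff lookup_add)

section \<open>Linear extension of maps on exponents\<close>

lemma poly_mapping_sum_single:
  "p = (\<Sum>a\<in>Poly_Mapping.keys p. Poly_Mapping.single a (Poly_Mapping.lookup p a))"
proof (rule poly_mapping_eqI)
  fix k
  show "Poly_Mapping.lookup p k = Poly_Mapping.lookup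
      (\<Sum>a\<in>Poly_Mapping.keys p. Poly_Mapping.single a (Poly_Mapping.lookup p a)) k"
    by (simp add: lookup_sum lookup_single when_def sum.delta in_keys_iff)
qed

text \<open>The target is a monoid algebra, where the scalar c is the element
  \<open>Poly_Mapping.single 0 c\<close>; multiplication by it replaces scalar
  multiplication.\<close>

definition linear_ext :: "('m \<Rightarrow> 'n::comm_monoid_add \<Rightarrow>\<^sub>0 'k) \<Rightarrow> ('m \<Rightarrow>\<^sub>0 'k::comm_ring_1) \<Rightarrow> 'n \<Rightarrow>\<^sub>0 'k" where
  "linear_ext f p =
     (\<Sum>a\<in>Poly_Mapping.keys p. Poly_Mapping.single 0 (Poly_Mapping.lookup p a) * f a)"

text \<open>Cancellation can make the keys of a sum smaller. Summing over one common finite set of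
  exponents lets two such sums be added termwise.\<close>

lemma linear_ext_superset:
  assumes "finite A" "Poly_Mapping.keys p \<subseteq> A"
  shows "linear_ext f p = (\<Sum>a\<in>A. Poly_Mapping.single 0 (Poly_Mapping.lookup p a) * f a)"
  unfolding linear_ext_def using assms by (intro sum.mono_neutral_left) (auto simp: in_keys_iff)

lemma linear_ext_zero [simp]: "linear_ext f 0 = 0"
  by (simp add: linear_ext_def)

lemma linear_ext_single [simp]:
  "linear_ext f (Poly_Mapping.single a c) = Poly_Mapping.single 0 c * f a"
  by (simp add: linear_ext_superset[of "{a}"])

lemma linear_ext_one [simp]: "linear_ext f 1 = f 0"
  by (simp add: linear_ext_superset[of "{0}"])

lemma linear_ext_add [simp]: "linear_ext f (p + q) = linear_ext f p + linear_ext f q"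
proof -
  let ?A = "Poly_Mapping.keys p \<union> Poly_Mapping.keys q"
  have "Poly_Mapping.keys (p + q) \<subseteq> ?A" by (rule Poly_Mapping.keys_add)
  then show ?thesis
    by (simp add: linear_ext_superset[of ?A] lookup_add single_add distrib_right sum.distrib)
qed

lemma linear_ext_uminus [simp]: "linear_ext f (- p) = - linear_ext f p"
  using linear_ext_add[of f p "- p"] by (simp add: eq_neg_iff_add_eq_0 add.commute)

lemma linear_ext_diff [simp]: "linear_ext f (p - q) = linear_ext f p - linear_ext f q"
  using linear_ext_add[of f p "- q"] by simp

lemma linear_ext_sum [simp]: "linear_ext f (sum p A) = (\<Sum>i\<in>A. linear_ext f (p i))"
  by (induction A rule: infinite_finite_induct) auto

text \<open>Expanding both factors into monomials reduces the claim to single exponents, as in the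
  universal property of a monoid algebra.\<close>

lemma linear_ext_mult:
  assumes "\<And>a b. f (a + b) = f a * f b"
  shows "linear_ext f (p * q) = linear_ext f p * linear_ext f q"
proof -
  let ?l = Poly_Mapping.lookup
  have "p * q = (\<Sum>a\<in>Poly_Mapping.keys p. \<Sum>b\<in>Poly_Mapping.keys q.
      Poly_Mapping.single (a + b) (?l p a * ?l q b))"
    by (subst poly_mapping_sum_single[of p], subst poly_mapping_sum_single[of q])
       (simp add: sum_product mult_single)
  then have "linear_ext f (p * q) = (\<Sum>a\<in>Poly_Mapping.keys p. \<Sum>b\<in>Poly_Mapping.keys q.
      (Poly_Mapping.single 0 (?l p a) * f a) * (Poly_Mapping.single 0 (?l q b) * f b))"
  proof (simp, intro sum.cong refl)
    fix a b
    have "Poly_Mapping.single 0 (?l p a * ?l q b) =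
        Poly_Mapping.single (0 :: 'b) (?l p a) * Poly_Mapping.single 0 (?l q b)"
      by (simp add: mult_single)
    then show "Poly_Mapping.single 0 (?l p a * ?l q b) * f (a + b) =
      Poly_Mapping.single 0 (?l p a) * f a * (Poly_Mapping.single 0 (?l q b) * f b)"
      by (simp add: assms mult_ac)
  qed
  then show ?thesis by (simp add: linear_ext_def sum_product)
qed

text \<open>This is the exponent of the image of \<open>M\<close> when every variable is replaced by
  the product of its labels; a multiset records the multiplicity of each label.\<close>

definition weight :: "('v \<Rightarrow> 'e set) \<Rightarrow> ('v \<Rightarrow>\<^sub>0 nat) \<Rightarrow> 'e multiset" where
  "weight \<sigma> M =
     (\<Sum>x\<in>Poly_Mapping.keys M. repeat_mset (Poly_Mapping.lookup M x) (mset_set (\<sigma> x)))"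

lemma weight_add [simp]: "weight \<sigma> (M + N) = weight \<sigma> M + weight \<sigma> N"
  unfolding weight_def by (rule setsum_keys_plus_distrib) (auto simp: repeat_mset_distrib)

lemma weight_zero [simp]: "weight \<sigma> 0 = {#}"
  by (simp add: weight_def)

lemma weight_single [simp]: "weight \<sigma> (Poly_Mapping.single x n) = repeat_mset n (mset_set (\<sigma> x))"
  by (cases "n = 0") (simp_all add: weight_def)

lemma set_mset_repeat: "set_mset (repeat_mset n M) = (if n = 0 then {} else set_mset M)"
  by (auto simp flip: count_greater_zero_iff)

lemma set_mset_weight:
  assumes "\<And>x. x \<in> Poly_Mapping.keys M \<Longrightarrow> finite (\<sigma> x)"
  shows "set_mset (weight \<sigma> M) = (\<Union>x\<in>Poly_Mapping.keys M. \<sigma> x)"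
  using assms by (auto simp: weight_def set_mset_sum set_mset_repeat in_keys_iff)

text \<open>An infinite label set contributes 0 on both sides: \<open>mset_set\<close> is then empty
  and \<open>card\<close> is 0.\<close>

lemma size_weight:
  "size (weight \<sigma> M) = (\<Sum>x\<in>Poly_Mapping.keys M. Poly_Mapping.lookup M x * card (\<sigma> x))"
  by (simp add: weight_def)

section \<open>Labelled simplicial posets\<close>

text \<open>Think of \<^term>\<open>\<sigma> x\<close> as the set of atoms below \<^term>\<open>x\<close>, and of \<^term>\<open>\<rho> x A\<close> as the
  element below \<^term>\<open>x\<close> with set of atoms \<^term>\<open>A\<close>. Different atoms may share a label, as long as
  they have no common upper bound.\<close>

locale labelled_simplicial_poset =
  fixes Q :: "'v gorder" and \<sigma> :: "'v \<Rightarrow> 'e set" and \<rho> :: "'v \<Rightarrow> 'e set \<Rightarrow> 'v"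
  assumes finite_carrier: "finite (carrier Q)"
    and nonempty: "carrier Q \<noteq> {}"
    and finite_label: "x \<in> carrier Q \<Longrightarrow> finite (\<sigma> x)"
    and face_closed: "\<lbrakk>x \<in> carrier Q; A \<subseteq> \<sigma> x\<rbrakk> \<Longrightarrow> \<rho> x A \<in> carrier Q"
    and label_face: "\<lbrakk>x \<in> carrier Q; A \<subseteq> \<sigma> x\<rbrakk> \<Longrightarrow> \<sigma> (\<rho> x A) = A"
    and face_face: "\<lbrakk>x \<in> carrier Q; A \<subseteq> \<sigma> x; B \<subseteq> A\<rbrakk> \<Longrightarrow> \<rho> (\<rho> x A) B = \<rho> x B"
    and face_self: "x \<in> carrier Q \<Longrightarrow> \<rho> x (\<sigma> x) = x"
    and le_iff: "\<lbrakk>x \<in> carrier Q; y \<in> carrier Q\<rbrakk>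
      \<Longrightarrow> x \<sqsubseteq>\<^bsub>Q\<^esub> y \<longleftrightarrow> \<sigma> x \<subseteq> \<sigma> y \<and> \<rho> y (\<sigma> x) = x"
    and empty_label_unique:
      "\<lbrakk>x \<in> carrier Q; y \<in> carrier Q; \<sigma> x = {}; \<sigma> y = {}\<rbrakk> \<Longrightarrow> x = y"
begin

section \<open>Order, meets and minimal upper bounds in terms of labels\<close>

lemma le_refl: "x \<in> carrier Q \<Longrightarrow> x \<sqsubseteq>\<^bsub>Q\<^esub> x"
  by (simp add: le_iff face_self)

lemma le_antisym:
  "\<lbrakk>x \<sqsubseteq>\<^bsub>Q\<^esub> y; y \<sqsubseteq>\<^bsub>Q\<^esub> x; x \<in> carrier Q; y \<in> carrier Q\<rbrakk> \<Longrightarrow> x = y"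
  by (metis le_iff face_self subset_antisym)

lemma le_trans:
  assumes "x \<sqsubseteq>\<^bsub>Q\<^esub> y" "y \<sqsubseteq>\<^bsub>Q\<^esub> z" "x \<in> carrier Q" "y \<in> carrier Q" "z \<in> carrier Q"
  shows "x \<sqsubseteq>\<^bsub>Q\<^esub> z"
proof -
  have *: "\<sigma> x \<subseteq> \<sigma> y" "\<rho> y (\<sigma> x) = x" "\<sigma> y \<subseteq> \<sigma> z" "\<rho> z (\<sigma> y) = y"
    using assms le_iff by auto
  then have "\<rho> z (\<sigma> x) = x" using face_face[of z "\<sigma> y" "\<sigma> x"] assms(5) by simp
  then show ?thesis using * assms by (simp add: le_iff)
qed

lemma face_le: "\<lbrakk>x \<in> carrier Q; A \<subseteq> \<sigma> x\<rbrakk> \<Longrightarrow> \<rho> x A \<sqsubseteq>\<^bsub>Q\<^esub> x"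
  by (simp add: le_iff face_closed label_face)

lemma label_mono: "\<lbrakk>x \<sqsubseteq>\<^bsub>Q\<^esub> y; x \<in> carrier Q; y \<in> carrier Q\<rbrakk> \<Longrightarrow> \<sigma> x \<subseteq> \<sigma> y"
  by (simp add: le_iff)

lemma face_label: "\<lbrakk>x \<sqsubseteq>\<^bsub>Q\<^esub> y; x \<in> carrier Q; y \<in> carrier Q\<rbrakk> \<Longrightarrow> \<rho> y (\<sigma> x) = x"
  by (simp add: le_iff)

text \<open>Below \<open>z\<close> both elements are faces of \<open>z\<close>, and a face of a face
  is a face. So inside an interval the order is inclusion of labels, which is how the Boolean
  intervals enter all later arguments.\<close>

lemma le_if_label_subset:
  assumes "x \<sqsubseteq>\<^bsub>Q\<^esub> z" "y \<sqsubseteq>\<^bsub>Q\<^esub> z" "\<sigma> x \<subseteq> \<sigma> y" "x \<in> carrier Q" "y \<in> carrier Q" "z \<in> carrier Q"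
  shows "x \<sqsubseteq>\<^bsub>Q\<^esub> y"
proof -
  have "\<rho> y (\<sigma> x) = \<rho> (\<rho> z (\<sigma> y)) (\<sigma> x)" using assms face_label by simp
  also have "\<dots> = x" using assms face_face[of z "\<sigma> y" "\<sigma> x"] label_mono face_label by simp
  finally show ?thesis using assms by (simp add: le_iff)
qed

lemma bottom_least: "least Q \<bottom>\<^bsub>Q\<^esub> (carrier Q)" and label_bottom: "\<sigma> \<bottom>\<^bsub>Q\<^esub> = {}"
proof -
  obtain x where x: "x \<in> carrier Q" using nonempty by blast
  have "\<rho> x {} \<sqsubseteq>\<^bsub>Q\<^esub> y" if y: "y \<in> carrier Q" for y
  proof -
    have "\<rho> x {} = \<rho> y {}"
      using x y by (intro empty_label_unique) (auto simp: face_closed label_face)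
    then show ?thesis using face_le[OF y] by simp
  qed
  then have *: "least Q (\<rho> x {}) (carrier Q)"
    using x by (auto simp: least_def face_closed)
  then show l: "least Q \<bottom>\<^bsub>Q\<^esub> (carrier Q)"
    \<comment> \<open>\<open>\<bottom>\<close> is a Hilbert choice, so a least element has to be
      exhibited first; antisymmetry then identifies the two.\<close>
    unfolding bottom_def by (rule someI)
  with * have "\<bottom>\<^bsub>Q\<^esub> = \<rho> x {}" by (intro le_antisym) (auto simp: least_def)
  then show "\<sigma> \<bottom>\<^bsub>Q\<^esub> = {}" using x by (simp add: label_face)
qed

lemma bottom_closed: "\<bottom>\<^bsub>Q\<^esub> \<in> carrier Q"
  and bottom_le: "x \<in> carrier Q \<Longrightarrow> \<bottom>\<^bsub>Q\<^esub> \<sqsubseteq>\<^bsub>Q\<^esub> x"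
  using bottom_least by (auto simp: least_def)

lemma label_eq_empty_iff: "x \<in> carrier Q \<Longrightarrow> \<sigma> x = {} \<longleftrightarrow> x = \<bottom>\<^bsub>Q\<^esub>"
  using empty_label_unique bottom_closed label_bottom by blast

text \<open>In the interval below \<open>z\<close> the meet is given by intersecting labels. It is
  also the meet in the whole poset, because every lower bound of \<open>x\<close> already lies below
  \<open>z\<close>.\<close>

lemma meet_eq_face:
  assumes "x \<sqsubseteq>\<^bsub>Q\<^esub> z" "y \<sqsubseteq>\<^bsub>Q\<^esub> z" "x \<in> carrier Q" "y \<in> carrier Q" "z \<in> carrier Q"
  shows "x \<sqinter>\<^bsub>Q\<^esub> y = \<rho> z (\<sigma> x \<inter> \<sigma> y)"
proof -
  let ?g = "\<rho> z (\<sigma> x \<inter> \<sigma> y)"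
  have sub: "\<sigma> x \<subseteq> \<sigma> z" "\<sigma> y \<subseteq> \<sigma> z" "\<sigma> x \<inter> \<sigma> y \<subseteq> \<sigma> z" using assms label_mono by blast+
  have g: "?g \<in> carrier Q" "\<sigma> ?g = \<sigma> x \<inter> \<sigma> y" "?g \<sqsubseteq>\<^bsub>Q\<^esub> z"
    using sub assms by (auto simp: face_closed label_face face_le)
  have "?g \<sqsubseteq>\<^bsub>Q\<^esub> x" "?g \<sqsubseteq>\<^bsub>Q\<^esub> y"
    using le_if_label_subset[OF g(3) assms(1)] le_if_label_subset[OF g(3) assms(2)] g assms by auto
  moreover have "w \<sqsubseteq>\<^bsub>Q\<^esub> ?g" if "w \<sqsubseteq>\<^bsub>Q\<^esub> x" "w \<sqsubseteq>\<^bsub>Q\<^esub> y" "w \<in> carrier Q" for w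
  proof (rule le_if_label_subset[OF _ g(3)])
    show "w \<sqsubseteq>\<^bsub>Q\<^esub> z" using le_trans[OF that(1) assms(1)] that(3) assms by blast
    show "\<sigma> w \<subseteq> \<sigma> ?g" using that label_mono assms g by auto
  qed (use that g assms in auto)
  ultimately have *: "greatest Q ?g (Lower Q {x, y})"
    using g(1) assms by (auto simp: greatest_def Lower_def)
  then have "greatest Q (x \<sqinter>\<^bsub>Q\<^esub> y) (Lower Q {x, y})"
    unfolding meet_def inf_def by (rule someI)
  with * show ?thesis
    by (intro le_antisym) (auto simp: greatest_def Lower_def)
qed

lemma in_UpperI:
  "\<lbrakk>x \<sqsubseteq>\<^bsub>Q\<^esub> z; y \<sqsubseteq>\<^bsub>Q\<^esub> z; z \<in> carrier Q\<rbrakk> \<Longrightarrow> z \<in> Upper Q {x, y}"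
  by (auto simp: Upper_def)

lemma in_UpperD:
  "\<lbrakk>z \<in> Upper Q {x, y}; x \<in> carrier Q; y \<in> carrier Q\<rbrakk> \<Longrightarrow> x \<sqsubseteq>\<^bsub>Q\<^esub> z \<and> y \<sqsubseteq>\<^bsub>Q\<^esub> z \<and> z \<in> carrier Q"
  by (auto simp: Upper_def)

text \<open>This face is the join inside the interval below \<open>z\<close>. Another
  \<open>z\<close> may yield another element with the same labels.\<close>

lemma face_join:
  assumes "x \<sqsubseteq>\<^bsub>Q\<^esub> z" "y \<sqsubseteq>\<^bsub>Q\<^esub> z" "x \<in> carrier Q" "y \<in> carrier Q" "z \<in> carrier Q"
  shows "\<rho> z (\<sigma> x \<union> \<sigma> y) \<in> Upper Q {x, y}" "\<sigma> (\<rho> z (\<sigma> x \<union> \<sigma> y)) = \<sigma> x \<union> \<sigma> y"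
    "\<rho> z (\<sigma> x \<union> \<sigma> y) \<sqsubseteq>\<^bsub>Q\<^esub> z"
proof -
  let ?g = "\<rho> z (\<sigma> x \<union> \<sigma> y)"
  have sub: "\<sigma> x \<union> \<sigma> y \<subseteq> \<sigma> z" using assms label_mono by blast
  have g: "?g \<in> carrier Q" "\<sigma> ?g = \<sigma> x \<union> \<sigma> y" "?g \<sqsubseteq>\<^bsub>Q\<^esub> z"
    using sub assms by (auto simp: face_closed label_face face_le)
  have "x \<sqsubseteq>\<^bsub>Q\<^esub> ?g" "y \<sqsubseteq>\<^bsub>Q\<^esub> ?g"
    using le_if_label_subset[OF assms(1) g(3)] le_if_label_subset[OF assms(2) g(3)] g assms by auto
  then show "?g \<in> Upper Q {x, y}" "\<sigma> ?g = \<sigma> x \<union> \<sigma> y" "?g \<sqsubseteq>\<^bsub>Q\<^esub> z"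
    using g by (auto intro: in_UpperI)
qed

text \<open>The join of \<open>x\<close> and \<open>y\<close> inside the interval below
  \<open>z\<close> is an upper bound, so minimality makes it equal to \<open>z\<close>; this gives
  the labels.\<close>

lemma minimal_upper_boundsD:
  assumes "z \<in> minimal_upper_bounds Q x y" "x \<in> carrier Q" "y \<in> carrier Q"
  shows "x \<sqsubseteq>\<^bsub>Q\<^esub> z" "y \<sqsubseteq>\<^bsub>Q\<^esub> z" "z \<in> carrier Q" "\<sigma> z = \<sigma> x \<union> \<sigma> y"
proof -
  have z: "z \<in> Upper Q {x, y}" "\<And>w. w \<in> Upper Q {x, y} \<Longrightarrow> w \<sqsubseteq>\<^bsub>Q\<^esub> z \<Longrightarrow> w = z"
    using assms(1) by (auto simp: minimal_upper_bounds_def)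
  show zz: "x \<sqsubseteq>\<^bsub>Q\<^esub> z" "y \<sqsubseteq>\<^bsub>Q\<^esub> z" "z \<in> carrier Q" using in_UpperD[OF z(1) assms(2,3)] by auto
  note j = face_join[OF zz(1,2) assms(2,3) zz(3)]
  show "\<sigma> z = \<sigma> x \<union> \<sigma> y" using z(2)[OF j(1) j(3)] j(2) by simp
qed

text \<open>Joins are unique in a Boolean interval. Hence exactly one summand of the
  Stanley--Reisner relation survives evaluation at \<open>z\<close>.\<close>

lemma minimal_upper_bounds_below:
  assumes "x \<sqsubseteq>\<^bsub>Q\<^esub> z" "y \<sqsubseteq>\<^bsub>Q\<^esub> z" "x \<in> carrier Q" "y \<in> carrier Q" "z \<in> carrier Q"
  shows "{w \<in> minimal_upper_bounds Q x y. w \<sqsubseteq>\<^bsub>Q\<^esub> z} = {\<rho> z (\<sigma> x \<union> \<sigma> y)}"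
proof -
  let ?g = "\<rho> z (\<sigma> x \<union> \<sigma> y)"
  note j = face_join[OF assms]
  have g: "?g \<in> carrier Q" using j(1) by (simp add: Upper_def)
  have "w = ?g" if w: "w \<in> Upper Q {x, y}" "w \<sqsubseteq>\<^bsub>Q\<^esub> ?g" for w
  proof -
    have w': "x \<sqsubseteq>\<^bsub>Q\<^esub> w" "y \<sqsubseteq>\<^bsub>Q\<^esub> w" "w \<in> carrier Q" using in_UpperD[OF w(1)] assms by auto
    have "\<sigma> ?g \<subseteq> \<sigma> w" using label_mono[OF w'(1)] label_mono[OF w'(2)] w'(3) assms j(2) by auto
    \<comment> \<open>The common upper bound in this comparison is \<open>?g\<close> itself.\<close>
    then have "?g \<sqsubseteq>\<^bsub>Q\<^esub> w"
      using le_if_label_subset[of ?g ?g w] w(2) le_refl[OF g] g w'(3) by auto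
    then show ?thesis using w(2) g w'(3) le_antisym by blast
  qed
  then have "?g \<in> minimal_upper_bounds Q x y" using j(1) by (auto simp: minimal_upper_bounds_def)
  moreover have "w = ?g" if "w \<in> minimal_upper_bounds Q x y" "w \<sqsubseteq>\<^bsub>Q\<^esub> z" for w
    using minimal_upper_boundsD[OF that(1)] face_label[OF that(2)] assms by metis
  ultimately show ?thesis using j(3) by blast
qed

text \<open>Adding the labels of \<open>A\<close> one at a time gives a chain with one more element
  than \<open>A\<close> has labels. This is the lower bound for
  \<open>interval_rank\<close>.\<close>

lemma chain_exists:
  assumes "y \<in> carrier Q" "A \<subseteq> \<sigma> y"
  shows "\<exists>C. C \<subseteq> {x \<in> carrier Q. x \<sqsubseteq>\<^bsub>Q\<^esub> \<rho> y A} \<and> card C = Suc (card A) \<and>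
    (\<forall>u\<in>C. \<forall>v\<in>C. u \<sqsubseteq>\<^bsub>Q\<^esub> v \<or> v \<sqsubseteq>\<^bsub>Q\<^esub> u)"
proof -
  have "finite A" using assms finite_label finite_subset by blast
  then show ?thesis using assms(2)
  proof (induction A)
    case empty
    have "\<rho> y {} \<in> carrier Q" using assms(1) by (simp add: face_closed)
    then show ?case by (intro exI[of _ "{\<rho> y {}}"]) (auto simp: le_refl)
  next
    case (insert a A)
    let ?x = "\<rho> y A" and ?z = "\<rho> y (insert a A)"
    have x: "?x \<in> carrier Q" "?z \<in> carrier Q" "\<sigma> ?x = A" "\<sigma> ?z = insert a A"
      using insert.prems assms(1) by (auto simp: face_closed label_face)
    have xz: "?x \<sqsubseteq>\<^bsub>Q\<^esub> ?z"
      using x face_face[OF assms(1) insert.prems, of A] by (auto simp: le_iff)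
    obtain C where C: "C \<subseteq> {x \<in> carrier Q. x \<sqsubseteq>\<^bsub>Q\<^esub> ?x}" "card C = Suc (card A)"
      "\<forall>u\<in>C. \<forall>v\<in>C. u \<sqsubseteq>\<^bsub>Q\<^esub> v \<or> v \<sqsubseteq>\<^bsub>Q\<^esub> u" using insert by auto
    have Cz: "\<forall>u\<in>C. u \<sqsubseteq>\<^bsub>Q\<^esub> ?z" using C(1) x xz le_trans by blast
    have "?z \<notin> C"
      using C(1) label_mono[of ?z ?x] x insert.hyps by auto
    moreover have "finite C" using C(2) card.infinite by fastforce
    ultimately show ?case
      using C Cz x le_refl insert.hyps by (intro exI[of _ "insert ?z C"]) auto
  qed
qed

lemma interval_rank_eq:
  assumes y: "y \<in> carrier Q"
  shows "interval_rank Q y = card (\<sigma> y)"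
  unfolding interval_rank_def
proof (rule Max_eqI)
  let ?I = "\<lbrace>\<bottom>\<^bsub>Q\<^esub>..y\<rbrace>\<^bsub>Q\<^esub>"
  let ?S = "{card C - 1 | C. C \<subseteq> ?I \<and> C \<noteq> {} \<and> (\<forall>u\<in>C. \<forall>v\<in>C. u \<sqsubseteq>\<^bsub>Q\<^esub> v \<or> v \<sqsubseteq>\<^bsub>Q\<^esub> u)}"
  have I: "?I = {x \<in> carrier Q. x \<sqsubseteq>\<^bsub>Q\<^esub> y}"
    by (auto simp: at_least_at_most_def bottom_le)
  have fin: "finite ?I" using finite_carrier by (simp add: I)
  have "?S \<subseteq> (\<lambda>C. card C - 1) ` Pow ?I" by auto
  then show "finite ?S" using fin finite_subset by blast
  show "n \<le> card (\<sigma> y)" if n: "n \<in> ?S" for n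
  proof -
    obtain C where C: "n = card C - 1" "C \<subseteq> ?I" "\<forall>u\<in>C. \<forall>v\<in>C. u \<sqsubseteq>\<^bsub>Q\<^esub> v \<or> v \<sqsubseteq>\<^bsub>Q\<^esub> u"
      using n by blast
    \<comment> \<open>Label sets along a chain are nested, so equal cardinality means equal labels,
      and a face of \<open>y\<close> is determined by its labels.\<close>
    have inj: "inj_on (card \<circ> \<sigma>) C"
    proof (rule inj_onI)
      fix u v assume uv: "u \<in> C" "v \<in> C" "(card \<circ> \<sigma>) u = (card \<circ> \<sigma>) v"
      have c: "u \<in> carrier Q" "v \<in> carrier Q" "u \<sqsubseteq>\<^bsub>Q\<^esub> y" "v \<sqsubseteq>\<^bsub>Q\<^esub> y" using uv C(2) I by auto
      have "\<sigma> u \<subseteq> \<sigma> v \<or> \<sigma> v \<subseteq> \<sigma> u" using C(3) uv label_mono c by blast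
      then have "\<sigma> u = \<sigma> v"
        using uv(3) finite_label[OF c(1)] finite_label[OF c(2)] card_subset_eq
        by (metis comp_apply)
      then show "u = v" using face_label[OF c(3) c(1) y] face_label[OF c(4) c(2) y] by metis
    qed
    have "card (\<sigma> u) \<le> card (\<sigma> y)" if "u \<in> C" for u
      using that C(2) y unfolding I by (intro card_mono finite_label label_mono) auto
    then have "(card \<circ> \<sigma>) ` C \<subseteq> {..card (\<sigma> y)}" by auto
    from card_mono[OF finite_atMost this] have "card C \<le> Suc (card (\<sigma> y))"
      unfolding card_image[OF inj] by simp
    then show ?thesis using C(1) by simp
  qed
  obtain C where C: "C \<subseteq> ?I" "card C = Suc (card (\<sigma> y))"
    "\<forall>u\<in>C. \<forall>v\<in>C. u \<sqsubseteq>\<^bsub>Q\<^esub> v \<or> v \<sqsubseteq>\<^bsub>Q\<^esub> u"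
    using chain_exists[OF y order_refl] unfolding I face_self[OF y] by metis
  have "C \<noteq> {}" using C(2) by force
  moreover have "card (\<sigma> y) = card C - 1" using C(2) by simp
  ultimately show "card (\<sigma> y) \<in> ?S" using C(1,3) by blast
qed

lemma monomial_degree_eq:
  assumes "Poly_Mapping.keys M \<subseteq> carrier Q"
  shows "monomial_degree Q M = size (weight \<sigma> M)"
  unfolding monomial_degree_def size_weight
  using assms by (intro sum.cong) (auto simp: interval_rank_eq)

end

section \<open>Counting chain monomials\<close>

lemma finite_multisets_size: "finite T \<Longrightarrow> finite {m. set_mset m = T \<and> size m = d}"
proof -
  assume "finite T"
  have "m \<in> mset ` {xs. set xs \<subseteq> T \<and> length xs = d}" if "set_mset m = T" "size m = d" for m
  proof -
    obtain xs where "mset xs = m" using ex_mset by blast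
    then show ?thesis using that by (intro image_eqI[of _ _ xs]) auto
  qed
  then have "{m. set_mset m = T \<and> size m = d} \<subseteq> mset ` {xs. set xs \<subseteq> T \<and> length xs = d}" by blast
  then show ?thesis
    by (rule finite_subset) (intro finite_imageI finite_lists_length_eq \<open>finite T\<close>)
qed

text \<open>Here k is the multiplicity of \<open>x\<close>. It starts at 1 because \<open>x\<close>
  has to occur.\<close>

lemma card_multisets_insert:
  assumes "finite T" "x \<notin> T"
  shows "card {m. set_mset m = insert x T \<and> size m = d} =
    (\<Sum>k=1..d. card {m. set_mset m = T \<and> size m = d - k})"
proof -
  let ?B = "SIGMA k:{1..d}. {m. set_mset m = T \<and> size m = d - k}"
  let ?f = "\<lambda>(k, m). replicate_mset k x + m"
  have sub: "set_mset m = T \<Longrightarrow> count m x = 0" for m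
    using assms(2) by (metis count_eq_zero_iff)
  have inj: "inj_on ?f ?B"
  proof (rule inj_onI)
    fix p q assume "p \<in> ?B" "q \<in> ?B" and eq: "?f p = ?f q"
    then obtain k m l n where pq: "p = (k, m)" "q = (l, n)" and mn: "set_mset m = T" "set_mset n = T"
      by blast
    have *: "replicate_mset k x + m = replicate_mset l x + n" using eq by (simp add: pq)
    have "k = count (replicate_mset k x + m) x" using sub[OF mn(1)] by simp
    also have "\<dots> = count (replicate_mset l x + n) x" by (simp only: *)
    also have "\<dots> = l" using sub[OF mn(2)] by simp
    finally have "k = l" .
    then show "p = q" using * by (simp add: pq)
  qed
  have sup: "m \<in> ?f ` ?B" if "m \<in> {m. set_mset m = insert x T \<and> size m = d}" for m
  proof (rule image_eqI[of _ _ "(count m x, filter_mset ((\<noteq>) x) m)"])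
    have m: "set_mset m = insert x T" "size m = d" using that by auto
    show eq: "m = ?f (count m x, filter_mset ((\<noteq>) x) m)"
      by (auto intro!: multiset_eqI)
    have "size m = count m x + size (filter_mset ((\<noteq>) x) m)"
      using arg_cong[where f = size, OF eq] by simp
    moreover have "count m x > 0" using m by simp
    ultimately show "(count m x, filter_mset ((\<noteq>) x) m) \<in> ?B"
      using m assms(2) by auto
  qed
  have sub_im: "?f p \<in> {m. set_mset m = insert x T \<and> size m = d}" if "p \<in> ?B" for p
    using that by (auto split: if_splits)
  have im: "?f ` ?B = {m. set_mset m = insert x T \<and> size m = d}"
    by (rule equalityI[OF image_subsetI[OF sub_im] subsetI[OF sup]])
  have "card {m. set_mset m = insert x T \<and> size m = d} = card ?B"
    using card_image[OF inj] unfolding im .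
  also have "\<dots> = (\<Sum>k=1..d. card {m. set_mset m = T \<and> size m = d - k})"
    by (intro card_SigmaI ballI finite_multisets_size finite_atLeastAtMost assms(1))
  finally show ?thesis .
qed

lemma fps_X_over_one_minus_X:
  "fps_X / (1 - fps_X) = (Abs_fps (\<lambda>n. if n = 0 then 0 else 1) :: 'a::field fps)"
proof -
  have "fps_X = Abs_fps (\<lambda>n. if n = 0 then 0 else 1 :: 'a) * (1 - fps_X)"
    by (rule fps_ext) (auto simp: algebra_simps)
  moreover have "1 - fps_X \<noteq> (0 :: 'a fps)"
    by (auto simp: fps_eq_iff intro!: exI[of _ 0])
  ultimately show ?thesis by (metis nonzero_mult_div_cancel_right)
qed

text \<open>Every element of \<open>T\<close> has its own positive multiplicity, and each of these
  free choices contributes one factor t + t^2 + ....\<close>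

lemma fps_card_multisets:
  assumes "finite T"
  shows "Abs_fps (\<lambda>d. of_nat (card {m. set_mset m = T \<and> size m = d})) =
    (fps_X / (1 - fps_X) :: 'a::field fps) ^ card T"
  using assms
proof (induction T)
  case empty
  have "card {m::'b multiset. set_mset m = {} \<and> size m = d} = (if d = 0 then 1 else 0)" for d
  proof -
    have "{m::'b multiset. set_mset m = {} \<and> size m = d} = (if d = 0 then {{#}} else {})" by auto
    then show ?thesis by simp
  qed
  then show ?case by (auto simp: fps_eq_iff)
next
  case (insert x T)
  let ?N = "\<lambda>d. card {m. set_mset m = T \<and> size m = d}"
  have "Abs_fps (\<lambda>d. of_nat (card {m. set_mset m = insert x T \<and> size m = d})) =
      fps_X / (1 - fps_X) * (Abs_fps (\<lambda>d. of_nat (?N d)) :: 'a fps)"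
  proof (rule fps_ext)
    fix d
    have "(\<Sum>i=0..d. (if i = 0 then 0 else 1) * of_nat (?N (d - i))) =
        (\<Sum>i=1..d. of_nat (?N (d - i)) :: 'a)"
      by (intro sum.mono_neutral_cong_right) auto
    then show "fps_nth (Abs_fps (\<lambda>d. of_nat (card {m. set_mset m = insert x T \<and> size m = d}))) d =
      fps_nth (fps_X / (1 - fps_X) * (Abs_fps (\<lambda>d. of_nat (?N d)) :: 'a fps)) d"
      by (simp add: fps_X_over_one_minus_X fps_mult_nth card_multisets_insert[OF insert.hyps(1,2)])
  qed
  also have "\<dots> = (fps_X / (1 - fps_X)) ^ card (insert x T)"
    unfolding insert.IH using insert.hyps by simp
  finally show ?case .
qed

lemma in_keys_split:
  assumes "t \<in> Poly_Mapping.keys (M :: 'v \<Rightarrow>\<^sub>0 nat)"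
  obtains M' where "M = Poly_Mapping.single t 1 + M'" "Poly_Mapping.keys M' \<subseteq> Poly_Mapping.keys M"
proof
  \<comment> \<open>The subtraction is truncated, but the exponent of \<open>t\<close> in
    \<open>M\<close> is positive.\<close>
  show "M = Poly_Mapping.single t 1 + (M - Poly_Mapping.single t 1)"
    using assms by (intro poly_mapping_eqI)
      (auto simp: lookup_add lookup_minus lookup_single when_def in_keys_iff)
  show "Poly_Mapping.keys (M - Poly_Mapping.single t 1) \<subseteq> Poly_Mapping.keys M"
    by (auto simp: lookup_minus in_keys_iff)
qed

section \<open>Chain monomials and their encoding by a top and a multiset\<close>

context labelled_simplicial_poset
begin

text \<open>The minimum is excluded because it equals 1 in the Stanley--Reisner ring. Exponents are
  arbitrary, so these monomials are multichains.\<close>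

definition chain_monomials :: "('v \<Rightarrow>\<^sub>0 nat) set" where
  "chain_monomials = {M. Poly_Mapping.keys M \<subseteq> carrier Q - {\<bottom>\<^bsub>Q\<^esub>} \<and>
     (\<forall>u\<in>Poly_Mapping.keys M. \<forall>v\<in>Poly_Mapping.keys M. u \<sqsubseteq>\<^bsub>Q\<^esub> v \<or> v \<sqsubseteq>\<^bsub>Q\<^esub> u)}"

lemma chain_monomials_subset:
  "\<lbrakk>M \<in> chain_monomials; Poly_Mapping.keys M' \<subseteq> Poly_Mapping.keys M\<rbrakk> \<Longrightarrow> M' \<in> chain_monomials"
  unfolding chain_monomials_def by blast

lemma set_mset_weight_carrier:
  "Poly_Mapping.keys M \<subseteq> carrier Q \<Longrightarrow> set_mset (weight \<sigma> M) = (\<Union>x\<in>Poly_Mapping.keys M. \<sigma> x)"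
  using finite_label by (intro set_mset_weight) auto

lemma chain_monomial_top:
  assumes "M \<in> chain_monomials" "M \<noteq> 0"
  obtains t where "t \<in> Poly_Mapping.keys M" "\<And>u. u \<in> Poly_Mapping.keys M \<Longrightarrow> u \<sqsubseteq>\<^bsub>Q\<^esub> t"
    "set_mset (weight \<sigma> M) = \<sigma> t" "t \<in> carrier Q" "\<sigma> t \<noteq> {}"
proof -
  let ?K = "Poly_Mapping.keys M"
  have K: "?K \<subseteq> carrier Q" "\<bottom>\<^bsub>Q\<^esub> \<notin> ?K"
    "\<And>u v. u \<in> ?K \<Longrightarrow> v \<in> ?K \<Longrightarrow> u \<sqsubseteq>\<^bsub>Q\<^esub> v \<or> v \<sqsubseteq>\<^bsub>Q\<^esub> u"
    using assms(1) by (auto simp: chain_monomials_def)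
  have "?K \<noteq> {}" using assms(2) by simp
  then obtain t where t: "t \<in> ?K" "\<And>u. u \<in> ?K \<Longrightarrow> card (\<sigma> u) \<le> card (\<sigma> t)"
    \<comment> \<open>A maximum of the number of labels is obtained as a minimum of its
      negative.\<close>
    using ex_is_arg_min_if_finite[of ?K "\<lambda>u. - int (card (\<sigma> u))"]
    by (auto simp: is_arg_min_linorder)
  have top: "u \<sqsubseteq>\<^bsub>Q\<^esub> t" if u: "u \<in> ?K" for u
  proof (rule ccontr)
    assume "\<not> u \<sqsubseteq>\<^bsub>Q\<^esub> t"
    then have tu: "t \<sqsubseteq>\<^bsub>Q\<^esub> u" using K(3) t(1) u by blast
    have c: "t \<in> carrier Q" "u \<in> carrier Q" using t(1) u K(1) by auto
    have "\<sigma> t = \<sigma> u"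
      using label_mono[OF tu c] t(2)[OF u] finite_label[OF c(2)] by (simp add: card_seteq)
    then have "t = u" using face_label[OF tu c] face_self[OF c(2)] by metis
    then show False using \<open>\<not> u \<sqsubseteq>\<^bsub>Q\<^esub> t\<close> le_refl c by simp
  qed
  have tc: "t \<in> carrier Q" "t \<noteq> \<bottom>\<^bsub>Q\<^esub>" using t(1) K(1,2) by auto
  have "set_mset (weight \<sigma> M) = \<sigma> t"
    unfolding set_mset_weight_carrier[OF K(1)]
  proof (intro subset_antisym UN_least)
    show "\<sigma> u \<subseteq> \<sigma> t" if "u \<in> ?K" for u
      using label_mono[OF top[OF that]] that K(1) tc(1) by blast
  qed (use t(1) in blast)
  then show ?thesis using that[OF t(1) top] tc label_eq_empty_iff[OF tc(1)] by blast
qed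

lemma weight_eq_empty_iff: "M \<in> chain_monomials \<Longrightarrow> weight \<sigma> M = {#} \<longleftrightarrow> M = 0"
  by (metis chain_monomial_top set_mset_eq_empty_iff weight_zero)

text \<open>The support of the weight is the label set of the top factor, and below \<open>y\<close>
  this determines the factor. Dividing by it leaves smaller monomials with equal weights. Without
  the common bound \<open>y\<close> two elements with the same labels would be confused.\<close>

lemma chain_monomial_eqI:
  assumes "M \<in> chain_monomials" "N \<in> chain_monomials" "y \<in> carrier Q"
    "\<And>u. u \<in> Poly_Mapping.keys M \<Longrightarrow> u \<sqsubseteq>\<^bsub>Q\<^esub> y" "\<And>u. u \<in> Poly_Mapping.keys N \<Longrightarrow> u \<sqsubseteq>\<^bsub>Q\<^esub> y"
    "weight \<sigma> M = weight \<sigma> N"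
  shows "M = N"
  using assms
proof (induction "size (weight \<sigma> M)" arbitrary: M N rule: less_induct)
  case less
  show ?case
  proof (cases "M = 0")
    case True
    then have "weight \<sigma> N = {#}" using less.prems(6) by simp
    then show ?thesis using True weight_eq_empty_iff less.prems(2) by blast
  next
    case False
    then have "N \<noteq> 0" using weight_eq_empty_iff[of M] weight_eq_empty_iff[of N] less.prems(1,2,6) by metis
    obtain t where t: "t \<in> Poly_Mapping.keys M" "set_mset (weight \<sigma> M) = \<sigma> t"
      "t \<in> carrier Q" "\<sigma> t \<noteq> {}" using chain_monomial_top[OF less.prems(1) False] by metis
    obtain s where s: "s \<in> Poly_Mapping.keys N" "set_mset (weight \<sigma> N) = \<sigma> s"
      "s \<in> carrier Q" using chain_monomial_top[OF less.prems(2) \<open>N \<noteq> 0\<close>] by metis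
    have "\<sigma> t = \<sigma> s" using t s less.prems(6) by metis
    moreover have "t \<sqsubseteq>\<^bsub>Q\<^esub> y" "s \<sqsubseteq>\<^bsub>Q\<^esub> y" using less.prems(4,5) t s by auto
    ultimately have "t = s" using face_label less.prems(3) t(3) s(3) by metis
    obtain M' where M: "M = Poly_Mapping.single t 1 + M'" "Poly_Mapping.keys M' \<subseteq> Poly_Mapping.keys M"
      using in_keys_split[OF t(1)] .
    obtain N' where N: "N = Poly_Mapping.single t 1 + N'" "Poly_Mapping.keys N' \<subseteq> Poly_Mapping.keys N"
      using in_keys_split[of t N] s(1) \<open>t = s\<close> by blast
    have w: "weight \<sigma> M = mset_set (\<sigma> t) + weight \<sigma> M'" "weight \<sigma> N = mset_set (\<sigma> t) + weight \<sigma> N'"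
      by (simp_all add: M(1) N(1))
    have "card (\<sigma> t) > 0" using t(3,4) finite_label by (simp add: card_gt_0_iff)
    then have "size (weight \<sigma> M') < size (weight \<sigma> M)" by (simp add: w)
    then have "M' = N'"
    proof (rule less.hyps)
      show "M' \<in> chain_monomials" "N' \<in> chain_monomials"
        using chain_monomials_subset M(2) N(2) less.prems(1,2) by blast+
      show "weight \<sigma> M' = weight \<sigma> N'" using w less.prems(6) by simp
    qed (use M(2) N(2) less.prems in auto)
    then show ?thesis by (simp add: M(1) N(1))
  qed
qed

text \<open>The factors are the faces of \<open>y\<close> on the nested sets of labels of
  multiplicity at least 1, 2, 3 and so on. The bound by the face on the support is part of the
  induction, since it makes every earlier factor comparable to the new top.\<close>

lemma chain_monomial_exists:
  assumes "y \<in> carrier Q" "set_mset m \<subseteq> \<sigma> y"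
  shows "\<exists>M\<in>chain_monomials. (\<forall>u\<in>Poly_Mapping.keys M. u \<sqsubseteq>\<^bsub>Q\<^esub> \<rho> y (set_mset m)) \<and> weight \<sigma> M = m"
  using assms(2)
proof (induction "size m" arbitrary: m rule: less_induct)
  case less
  show ?case
  proof (cases "m = {#}")
    case True
    then show ?thesis by (intro bexI[of _ 0]) (auto simp: chain_monomials_def)
  next
    case False
    \<comment> \<open>\<open>?m\<close> loses one copy of every label that occurs, the copies used
      by the factor \<open>?t\<close>.\<close>
    let ?T = "set_mset m" and ?m = "m - mset_set (set_mset m)"
    let ?t = "\<rho> y ?T" and ?s = "\<rho> y (set_mset ?m)"
    have m: "m = mset_set ?T + ?m"
      using mset_set_set_mset_msubset[of m] by simp
    have sub: "set_mset ?m \<subseteq> ?T" by (meson in_diffD subsetI)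
    have t: "?t \<in> carrier Q" "\<sigma> ?t = ?T" using less.prems assms(1) by (auto simp: face_closed label_face)
    have s: "?s \<in> carrier Q" "\<sigma> ?s = set_mset ?m"
      using less.prems sub assms(1) by (auto simp: face_closed label_face)
    have st: "?s \<sqsubseteq>\<^bsub>Q\<^esub> ?t"
      using s t sub less.prems assms(1) face_face[OF assms(1) less.prems sub] by (simp add: le_iff)
    have "size m = size (mset_set ?T) + size ?m" by (subst m) simp
    moreover have "size (mset_set ?T) > 0" using False by (simp add: card_gt_0_iff)
    ultimately have lt: "size ?m < size m" by simp
    have "set_mset ?m \<subseteq> \<sigma> y" using sub less.prems by blast
    from less.hyps[OF lt this] obtain M where M: "M \<in> chain_monomials"
      "\<And>u. u \<in> Poly_Mapping.keys M \<Longrightarrow> u \<sqsubseteq>\<^bsub>Q\<^esub> ?s" "weight \<sigma> M = ?m" by blast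
    have Mc: "Poly_Mapping.keys M \<subseteq> carrier Q" using M(1) by (auto simp: chain_monomials_def)
    have Mt: "u \<sqsubseteq>\<^bsub>Q\<^esub> ?t" if "u \<in> Poly_Mapping.keys M" for u
      using le_trans[OF M(2)[OF that] st] that Mc s t by blast
    have tb: "?t \<noteq> \<bottom>\<^bsub>Q\<^esub>" using t label_eq_empty_iff[of ?t] False by auto
    let ?M = "Poly_Mapping.single ?t 1 + M"
    have k: "Poly_Mapping.keys ?M = insert ?t (Poly_Mapping.keys M)"
      by (simp add: keys_add_nat)
    have "?M \<in> chain_monomials"
      using M(1)[unfolded chain_monomials_def mem_Collect_eq] Mt t(1) tb le_refl[OF t(1)]
      unfolding chain_monomials_def mem_Collect_eq k by auto
    moreover have "weight \<sigma> ?M = m" using m by (simp add: t M(3))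
    moreover have "\<forall>u\<in>Poly_Mapping.keys ?M. u \<sqsubseteq>\<^bsub>Q\<^esub> ?t" unfolding k using Mt le_refl[OF t(1)] by blast
    ultimately show ?thesis by blast
  qed
qed

text \<open>The top need not be a factor: the monomial 1 gets the minimum as its top, so that it is
  counted by the term of rank 0.\<close>

definition is_top :: "('v \<Rightarrow>\<^sub>0 nat) \<Rightarrow> 'v \<Rightarrow> bool" where
  "is_top M y \<longleftrightarrow> y \<in> carrier Q \<and> \<sigma> y = set_mset (weight \<sigma> M) \<and>
     (\<forall>u\<in>Poly_Mapping.keys M. u \<sqsubseteq>\<^bsub>Q\<^esub> y)"

lemma is_top_exists: "M \<in> chain_monomials \<Longrightarrow> \<exists>y. is_top M y"
proof (cases "M = 0")
  case True
  then show ?thesis using bottom_closed label_bottom by (auto simp: is_top_def)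
next
  case False
  assume "M \<in> chain_monomials"
  then show ?thesis using chain_monomial_top[OF _ False] unfolding is_top_def by metis
qed

lemma is_top_unique:
  assumes "M \<in> chain_monomials" "is_top M y" "is_top M z"
  shows "y = z"
proof (cases "M = 0")
  case True
  then show ?thesis using assms empty_label_unique by (auto simp: is_top_def)
next
  case False
  then obtain t where t: "t \<in> Poly_Mapping.keys M" "set_mset (weight \<sigma> M) = \<sigma> t" "t \<in> carrier Q"
    using chain_monomial_top[OF assms(1)] by metis
  then have "t = y" "t = z" using assms(2,3) face_label face_self unfolding is_top_def by metis+
  then show ?thesis by simp
qed

text \<open>Injectivity is \<open>chain_monomial_eqI\<close> below the common top. Surjectivity is
  \<open>chain_monomial_exists\<close> for a multiset with full support, where the bounding face is
  \<open>y\<close> itself.\<close>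

lemma bij_betw_chain_monomials:
  "bij_betw (\<lambda>M. (THE y. is_top M y, weight \<sigma> M)) {M \<in> chain_monomials. size (weight \<sigma> M) = d}
    (SIGMA y:carrier Q. {m. set_mset m = \<sigma> y \<and> size m = d})"
  (is "bij_betw ?f ?A ?B")
proof (rule bij_betw_imageI)
  have the: "(THE y. is_top M y) = y" if "M \<in> chain_monomials" "is_top M y" for M y
    using that is_top_unique by blast
  show "inj_on ?f ?A"
  proof (rule inj_onI)
    fix M N assume M: "M \<in> ?A" and N: "N \<in> ?A" and eq: "?f M = ?f N"
    obtain y z where yz: "is_top M y" "is_top N z" using M N is_top_exists by blast
    then have "y = z" using M N eq the[of M y] the[of N z] by simp
    then show "M = N"
      using M N eq yz by (intro chain_monomial_eqI[of M N y]) (auto simp: is_top_def)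
  qed
  show "?f ` ?A = ?B"
  proof (intro subset_antisym subsetI)
    fix p assume "p \<in> ?f ` ?A"
    then obtain M where M: "M \<in> ?A" "p = ?f M" by blast
    then obtain y where "is_top M y" using is_top_exists by blast
    then show "p \<in> ?B" using M the by (auto simp: is_top_def)
  next
    fix p assume "p \<in> ?B"
    then obtain y m where p: "p = (y, m)" "y \<in> carrier Q" "set_mset m = \<sigma> y" "size m = d" by blast
    obtain M where M: "M \<in> chain_monomials" "\<forall>u\<in>Poly_Mapping.keys M. u \<sqsubseteq>\<^bsub>Q\<^esub> \<rho> y (set_mset m)"
      "weight \<sigma> M = m" using chain_monomial_exists[of y m] p by auto
    have "is_top M y" using M p face_self by (simp add: is_top_def)
    then show "p \<in> ?f ` ?A" using M p the by (intro image_eqI[of _ _ M]) auto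
  qed
qed

lemma finite_chain_monomials: "finite {M \<in> chain_monomials. size (weight \<sigma> M) = d}"
  unfolding bij_betw_finite[OF bij_betw_chain_monomials]
  by (intro finite_SigmaI finite_carrier finite_multisets_size finite_label)

lemma fps_card_chain_monomials:
  "Abs_fps (\<lambda>d. of_nat (card {M \<in> chain_monomials. size (weight \<sigma> M) = d})) =
    (\<Sum>y\<in>carrier Q. (fps_X / (1 - fps_X) :: 'a::field fps) ^ card (\<sigma> y))"
proof -
  have "of_nat (card {M \<in> chain_monomials. size (weight \<sigma> M) = d}) =
    fps_nth (\<Sum>y\<in>carrier Q.
      Abs_fps (\<lambda>d. of_nat (card {m. set_mset m = \<sigma> y \<and> size m = d})) :: 'a fps) d"
    for d
    unfolding bij_betw_same_card[OF bij_betw_chain_monomials] fps_sum_nth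
    using finite_carrier finite_multisets_size finite_label by (subst card_SigmaI) auto
  then show ?thesis
    by (intro fps_ext) (simp add: fps_card_multisets finite_label)
qed

end

section \<open>Linear independence of the chain monomials\<close>

lemma mpoly_ring_sel [simp]:
  "x \<otimes>\<^bsub>mpoly_ring V\<^esub> y = x * y" "x \<oplus>\<^bsub>mpoly_ring V\<^esub> y = x + y"
  "\<zero>\<^bsub>mpoly_ring V\<^esub> = 0" "\<one>\<^bsub>mpoly_ring V\<^esub> = 1"
  by (simp_all add: mpoly_ring_def)

lemma mem_mpoly_ring:
  "p \<in> carrier (mpoly_ring V) \<longleftrightarrow> (\<forall>M\<in>Poly_Mapping.keys p. Poly_Mapping.keys M \<subseteq> V)"
  by (simp add: mpoly_ring_def)

lemma mpoly_ring_ring: "ring (mpoly_ring V :: (('v \<Rightarrow>\<^sub>0 nat) \<Rightarrow>\<^sub>0 'k::field) ring)"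
  using mpoly_ring_cring cring.axioms(1) by blast

lemma mpoly_ring_closed:
  fixes p q :: "('v \<Rightarrow>\<^sub>0 nat) \<Rightarrow>\<^sub>0 'k::field"
  assumes "p \<in> carrier (mpoly_ring V)" "q \<in> carrier (mpoly_ring V)"
  shows "p + q \<in> carrier (mpoly_ring V)" "p * q \<in> carrier (mpoly_ring V)"
    "- p \<in> carrier (mpoly_ring V)" "p - q \<in> carrier (mpoly_ring V)"
proof -
  interpret ring "mpoly_ring V :: (('v \<Rightarrow>\<^sub>0 nat) \<Rightarrow>\<^sub>0 'k) ring" by (rule mpoly_ring_ring)
  show "p + q \<in> carrier (mpoly_ring V)" "p * q \<in> carrier (mpoly_ring V)"
    using a_closed[OF assms] m_closed[OF assms] by simp_all
  have neg: "- r \<in> carrier (mpoly_ring V)" if "r \<in> carrier (mpoly_ring V)"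
    for r :: "('v \<Rightarrow>\<^sub>0 nat) \<Rightarrow>\<^sub>0 'k"
    using that by (simp add: mem_mpoly_ring)
  show "- p \<in> carrier (mpoly_ring V)" "p - q \<in> carrier (mpoly_ring V)"
    using neg[OF assms(1)] a_closed[OF assms(1) neg[OF assms(2)]] by simp_all
qed

lemma mpoly_ring_sum_closed:
  fixes p :: "'i \<Rightarrow> ('v \<Rightarrow>\<^sub>0 nat) \<Rightarrow>\<^sub>0 'k::field"
  shows "(\<And>i. i \<in> A \<Longrightarrow> p i \<in> carrier (mpoly_ring V)) \<Longrightarrow> sum p A \<in> carrier (mpoly_ring V)"
  by (induction A rule: infinite_finite_induct) (auto simp: mpoly_ring_closed, auto simp: mem_mpoly_ring)

lemma mpoly_ring_a_inv:
  assumes "p \<in> carrier (mpoly_ring V)"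
  shows "\<ominus>\<^bsub>mpoly_ring V\<^esub> p = - (p :: ('v \<Rightarrow>\<^sub>0 nat) \<Rightarrow>\<^sub>0 'k::field)"
proof -
  interpret ring "mpoly_ring V :: (('v \<Rightarrow>\<^sub>0 nat) \<Rightarrow>\<^sub>0 'k) ring" by (rule mpoly_ring_ring)
  show ?thesis by (rule minus_equality) (use assms mpoly_ring_closed in auto)
qed

lemma mvar_closed: "x \<in> V \<Longrightarrow> mvar x \<in> carrier (mpoly_ring V)"
  and mconst_closed: "mconst c \<in> carrier (mpoly_ring V)"
  and mono_closed: "Poly_Mapping.keys M \<subseteq> V \<Longrightarrow> Poly_Mapping.single M c \<in> carrier (mpoly_ring V)"
  and one_closed: "1 \<in> carrier (mpoly_ring V)"
  by (auto simp: mem_mpoly_ring mvar_def mconst_def)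

lemma mpoly_ring_coset_eq_iff:
  fixes p q :: "('v \<Rightarrow>\<^sub>0 nat) \<Rightarrow>\<^sub>0 'k::field"
  assumes "ideal I (mpoly_ring V)" "p \<in> carrier (mpoly_ring V)" "q \<in> carrier (mpoly_ring V)"
  shows "I +>\<^bsub>mpoly_ring V\<^esub> p = I +>\<^bsub>mpoly_ring V\<^esub> q \<longleftrightarrow> p - q \<in> I"
  using ring.quotient_eq_iff_same_a_r_cos[OF mpoly_ring_ring assms] assms(3)
  by (simp add: a_minus_def mpoly_ring_a_inv)

lemma mpoly_ring_idealI:
  fixes J :: "(('v \<Rightarrow>\<^sub>0 nat) \<Rightarrow>\<^sub>0 'k::field) set"
  assumes "J \<subseteq> carrier (mpoly_ring V)" "0 \<in> J" "\<And>p q. p \<in> J \<Longrightarrow> q \<in> J \<Longrightarrow> p - q \<in> J"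
    "\<And>p q. p \<in> J \<Longrightarrow> q \<in> carrier (mpoly_ring V) \<Longrightarrow> q * p \<in> J"
  shows "ideal J (mpoly_ring V)"
proof (rule idealI[OF mpoly_ring_ring])
  interpret ring "mpoly_ring V :: (('v \<Rightarrow>\<^sub>0 nat) \<Rightarrow>\<^sub>0 'k) ring" by (rule mpoly_ring_ring)
  have neg: "- p \<in> J" if "p \<in> J" for p using assms(3)[OF assms(2) that] by simp
  show "subgroup J (add_monoid (mpoly_ring V))"
  proof (rule add.subgroupI)
    show "\<ominus>\<^bsub>mpoly_ring V\<^esub> p \<in> J" if "p \<in> J" for p
      using neg[OF that] mpoly_ring_a_inv[of p V] that assms(1) by auto
    show "p \<oplus>\<^bsub>mpoly_ring V\<^esub> q \<in> J" if "p \<in> J" "q \<in> J" for p q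
      using assms(3)[OF that(1) neg[OF that(2)]] by simp
  qed (use assms in auto)
qed (use assms in \<open>auto simp: mult.commute\<close>)

lemma mpoly_ring_idealD:
  fixes I :: "(('v \<Rightarrow>\<^sub>0 nat) \<Rightarrow>\<^sub>0 'k::field) set"
  assumes "ideal I (mpoly_ring V)"
  shows "I \<subseteq> carrier (mpoly_ring V)" "0 \<in> I" "p \<in> I \<Longrightarrow> q \<in> I \<Longrightarrow> p + q \<in> I"
    "p \<in> I \<Longrightarrow> q \<in> carrier (mpoly_ring V) \<Longrightarrow> q * p \<in> I" "p \<in> I \<Longrightarrow> - p \<in> I"
proof -
  interpret ideal I "mpoly_ring V" by (rule assms)
  show sub: "I \<subseteq> carrier (mpoly_ring V)" using a_subset by simp
  show "0 \<in> I" using additive_subgroup.zero_closed[OF is_additive_subgroup] by simp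
  show "p \<in> I \<Longrightarrow> q \<in> I \<Longrightarrow> p + q \<in> I" using additive_subgroup.a_closed[OF is_additive_subgroup, of p q] by simp
  show "p \<in> I \<Longrightarrow> q \<in> carrier (mpoly_ring V) \<Longrightarrow> q * p \<in> I" using I_l_closed[of p q] by simp
  show "p \<in> I \<Longrightarrow> - p \<in> I" using additive_subgroup.a_inv_closed[OF is_additive_subgroup, of p] sub mpoly_ring_a_inv[of p V] by auto
qed

section \<open>Evaluation below a fixed element\<close>

context labelled_simplicial_poset
begin

text \<open>The point is that the meet in a relation is an element of the poset: a common upper
  bound exists, so \<open>meet_eq_face\<close> applies.\<close>

lemma SR_generators_closed:
  "{mvar x * mvar y | x y. x \<in> carrier Q \<and> y \<in> carrier Q \<and> Upper Q {x, y} = {}} \<union>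
   {mvar x * mvar y - mvar (x \<sqinter>\<^bsub>Q\<^esub> y) * (\<Sum>z \<in> minimal_upper_bounds Q x y. mvar z) | x y.
      x \<in> carrier Q \<and> y \<in> carrier Q \<and> Upper Q {x, y} \<noteq> {}} \<union> {mvar \<bottom>\<^bsub>Q\<^esub> - 1}
   \<subseteq> carrier (mpoly_ring (carrier Q) :: (('v \<Rightarrow>\<^sub>0 nat) \<Rightarrow>\<^sub>0 'k::field) ring)"
proof -
  let ?R = "mpoly_ring (carrier Q) :: (('v \<Rightarrow>\<^sub>0 nat) \<Rightarrow>\<^sub>0 'k) ring"
  have xy: "mvar x * mvar y \<in> carrier ?R" if "x \<in> carrier Q" "y \<in> carrier Q" for x y
    using that by (intro mpoly_ring_closed mvar_closed)
  have "mvar x * mvar y - mvar (x \<sqinter>\<^bsub>Q\<^esub> y) * (\<Sum>z \<in> minimal_upper_bounds Q x y. mvar z)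
      \<in> carrier ?R"
    if xy: "x \<in> carrier Q" "y \<in> carrier Q" "Upper Q {x, y} \<noteq> {}" for x y
  proof -
    obtain z where "z \<in> Upper Q {x, y}" using xy by blast
    then have z: "x \<sqsubseteq>\<^bsub>Q\<^esub> z" "y \<sqsubseteq>\<^bsub>Q\<^esub> z" "z \<in> carrier Q" using in_UpperD xy by auto
    have "\<sigma> x \<inter> \<sigma> y \<subseteq> \<sigma> z" using label_mono[OF z(1) xy(1) z(3)] by blast
    then have "x \<sqinter>\<^bsub>Q\<^esub> y \<in> carrier Q"
      unfolding meet_eq_face[OF z(1,2) xy(1,2) z(3)] by (rule face_closed[OF z(3)])
    then show ?thesis
      using minimal_upper_boundsD(3)[OF _ xy(1,2)] xy(1,2)
      by (intro mpoly_ring_closed mpoly_ring_sum_closed mvar_closed) auto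
  qed
  moreover have "mvar \<bottom>\<^bsub>Q\<^esub> - 1 \<in> carrier ?R"
    using bottom_closed by (intro mpoly_ring_closed mvar_closed one_closed)
  ultimately show ?thesis using xy by blast
qed

lemma SR_ideal_ideal:
  "ideal (SR_ideal Q) (mpoly_ring (carrier Q) :: (('v \<Rightarrow>\<^sub>0 nat) \<Rightarrow>\<^sub>0 'k::field) ring)"
  unfolding SR_ideal_def by (rule ring.genideal_ideal[OF mpoly_ring_ring SR_generators_closed])

lemma SR_ideal_generators:
  "\<lbrakk>x \<in> carrier Q; y \<in> carrier Q; Upper Q {x, y} = {}\<rbrakk>
    \<Longrightarrow> (mvar x * mvar y :: ('v \<Rightarrow>\<^sub>0 nat) \<Rightarrow>\<^sub>0 'k::field) \<in> SR_ideal Q"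
  "\<lbrakk>x \<in> carrier Q; y \<in> carrier Q; Upper Q {x, y} \<noteq> {}\<rbrakk>
    \<Longrightarrow> (mvar x * mvar y - mvar (x \<sqinter>\<^bsub>Q\<^esub> y) * (\<Sum>z \<in> minimal_upper_bounds Q x y. mvar z)
      :: ('v \<Rightarrow>\<^sub>0 nat) \<Rightarrow>\<^sub>0 'k) \<in> SR_ideal Q"
  "(mvar \<bottom>\<^bsub>Q\<^esub> - 1 :: ('v \<Rightarrow>\<^sub>0 nat) \<Rightarrow>\<^sub>0 'k) \<in> SR_ideal Q"
proof -
  note * = ring.genideal_self[OF mpoly_ring_ring SR_generators_closed, folded SR_ideal_def]
  show "\<lbrakk>x \<in> carrier Q; y \<in> carrier Q; Upper Q {x, y} = {}\<rbrakk>
      \<Longrightarrow> (mvar x * mvar y :: ('v \<Rightarrow>\<^sub>0 nat) \<Rightarrow>\<^sub>0 'k) \<in> SR_ideal Q"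
    by (rule subsetD[OF *]) blast
  show "\<lbrakk>x \<in> carrier Q; y \<in> carrier Q; Upper Q {x, y} \<noteq> {}\<rbrakk>
    \<Longrightarrow> (mvar x * mvar y - mvar (x \<sqinter>\<^bsub>Q\<^esub> y) * (\<Sum>z \<in> minimal_upper_bounds Q x y. mvar z)
      :: ('v \<Rightarrow>\<^sub>0 nat) \<Rightarrow>\<^sub>0 'k) \<in> SR_ideal Q"
    by (rule subsetD[OF *]) blast
  show "(mvar \<bottom>\<^bsub>Q\<^esub> - 1 :: ('v \<Rightarrow>\<^sub>0 nat) \<Rightarrow>\<^sub>0 'k) \<in> SR_ideal Q"
    by (rule subsetD[OF *]) blast
qed

text \<open>A monomial in the atoms is encoded as the multiset of their labels.\<close>

definition eval_at :: "'v \<Rightarrow> (('v \<Rightarrow>\<^sub>0 nat) \<Rightarrow>\<^sub>0 'k::field) \<Rightarrow> 'e multiset \<Rightarrow>\<^sub>0 'k" where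
  "eval_at y = linear_ext (\<lambda>M. if Poly_Mapping.keys M \<subseteq> {x. x \<sqsubseteq>\<^bsub>Q\<^esub> y}
     then Poly_Mapping.single (weight \<sigma> M) 1 else 0)"

text \<open>A product of monomials has all its variables below \<open>y\<close> exactly when both
  factors do, so the truncation to 0 is multiplicative.\<close>

lemma eval_at_mult: "eval_at y (p * q) = eval_at y p * eval_at y q"
  unfolding eval_at_def by (rule linear_ext_mult) (auto simp: keys_add_nat mult_single)

lemma eval_at_diff: "eval_at y (p - q) = eval_at y p - eval_at y q"
  and eval_at_sum: "eval_at y (\<Sum>i\<in>A. r i) = (\<Sum>i\<in>A. eval_at y (r i))"
  by (simp_all add: eval_at_def)

lemma eval_at_mvar:
  "eval_at y (mvar x) = (if x \<sqsubseteq>\<^bsub>Q\<^esub> y then Poly_Mapping.single (mset_set (\<sigma> x)) 1 else 0)"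
  by (simp add: eval_at_def mvar_def mult_single)

lemma eval_at_SR_ideal:
  fixes p :: "('v \<Rightarrow>\<^sub>0 nat) \<Rightarrow>\<^sub>0 'k::field"
  assumes y: "y \<in> carrier Q" and p: "p \<in> SR_ideal Q"
  shows "eval_at y p = 0"
proof -
  let ?J = "{p \<in> carrier (mpoly_ring (carrier Q)). eval_at y p = (0 :: 'e multiset \<Rightarrow>\<^sub>0 'k)}"
  have J: "ideal ?J (mpoly_ring (carrier Q))"
    by (rule mpoly_ring_idealI)
       (auto simp: mpoly_ring_closed eval_at_mult eval_at_diff, auto simp: eval_at_def mem_mpoly_ring)
  \<comment> \<open>If neither factor vanished, \<open>y\<close> would be a common upper
    bound.\<close>
  have 1: "eval_at y (mvar u * mvar v) = (0 :: 'e multiset \<Rightarrow>\<^sub>0 'k)"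
    if "u \<in> carrier Q" "v \<in> carrier Q" "Upper Q {u, v} = {}" for u v
    using in_UpperI[of u y v] y that by (auto simp: eval_at_mult eval_at_mvar)
  have 2: "eval_at y (mvar u * mvar v - mvar (u \<sqinter>\<^bsub>Q\<^esub> v) * (\<Sum>z \<in> minimal_upper_bounds Q u v. mvar z))
      = (0 :: 'e multiset \<Rightarrow>\<^sub>0 'k)"
    if uv: "u \<in> carrier Q" "v \<in> carrier Q" for u v
  proof (cases "u \<sqsubseteq>\<^bsub>Q\<^esub> y \<and> v \<sqsubseteq>\<^bsub>Q\<^esub> y")
    case True
    let ?g = "\<rho> y (\<sigma> u \<union> \<sigma> v)"
    have T: "u \<sqsubseteq>\<^bsub>Q\<^esub> y" "v \<sqsubseteq>\<^bsub>Q\<^esub> y" using True by auto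
    have fin: "finite (minimal_upper_bounds Q u v)"
      using minimal_upper_boundsD(3)[OF _ uv] finite_carrier by (meson finite_subset subsetI)
    have "(\<Sum>z\<in>minimal_upper_bounds Q u v. eval_at y (mvar z) :: 'e multiset \<Rightarrow>\<^sub>0 'k) =
      (\<Sum>z\<in>{w \<in> minimal_upper_bounds Q u v. w \<sqsubseteq>\<^bsub>Q\<^esub> y}. Poly_Mapping.single (mset_set (\<sigma> z)) 1)"
      using fin by (intro sum.mono_neutral_cong_right) (auto simp: eval_at_mvar)
    also have "\<dots> = Poly_Mapping.single (mset_set (\<sigma> u \<union> \<sigma> v)) 1"
      unfolding minimal_upper_bounds_below[OF T uv y] using face_join(2)[OF T uv y] by simp
    finally have j: "(\<Sum>z\<in>minimal_upper_bounds Q u v. eval_at y (mvar z) :: 'e multiset \<Rightarrow>\<^sub>0 'k) =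
      Poly_Mapping.single (mset_set (\<sigma> u \<union> \<sigma> v)) 1" .
    have sub: "\<sigma> u \<inter> \<sigma> v \<subseteq> \<sigma> y" using label_mono[OF T(1) uv(1) y] by blast
    have m: "eval_at y (mvar (u \<sqinter>\<^bsub>Q\<^esub> v)) =
        (Poly_Mapping.single (mset_set (\<sigma> u \<inter> \<sigma> v)) 1 :: 'e multiset \<Rightarrow>\<^sub>0 'k)"
      unfolding meet_eq_face[OF T uv y] eval_at_mvar
      using face_le[OF y sub] label_face[OF y sub] by simp
    \<comment> \<open>With multiplicities, both sides count a common label twice and any other label
      once; this makes the two terms of the relation cancel.\<close>
    have "mset_set (\<sigma> u) + mset_set (\<sigma> v) = mset_set (\<sigma> u \<inter> \<sigma> v) + mset_set (\<sigma> u \<union> \<sigma> v)"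
      using finite_label[OF uv(1)] finite_label[OF uv(2)]
      by (intro multiset_eqI) (auto simp: count_mset_set')
    then show ?thesis
      using T by (simp add: eval_at_diff eval_at_mult eval_at_sum j m) (simp add: eval_at_mvar mult_single)
  next
    case False
    \<comment> \<open>A minimal upper bound below \<open>y\<close> would bring both \<open>u\<close>
      and \<open>v\<close> below \<open>y\<close>, so here both terms of the relation
      vanish.\<close>
    have "\<not> z \<sqsubseteq>\<^bsub>Q\<^esub> y" if "z \<in> minimal_upper_bounds Q u v" for z
      using minimal_upper_boundsD[OF that uv] False le_trans uv y by blast
    then have "(\<Sum>z\<in>minimal_upper_bounds Q u v. eval_at y (mvar z) :: 'e multiset \<Rightarrow>\<^sub>0 'k) = 0"
      by (intro sum.neutral) (simp add: eval_at_mvar)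
    then show ?thesis
      using False by (auto simp add: eval_at_diff eval_at_mult eval_at_sum) (auto simp: eval_at_mvar)
  qed
  have "eval_at y 1 = (1 :: 'e multiset \<Rightarrow>\<^sub>0 'k)"
    by (simp add: eval_at_def)
  then have 3: "eval_at y (mvar \<bottom>\<^bsub>Q\<^esub> - 1) = (0 :: 'e multiset \<Rightarrow>\<^sub>0 'k)"
    by (simp add: eval_at_diff eval_at_mvar bottom_le[OF y] label_bottom)
  have "SR_ideal Q \<subseteq> ?J"
    unfolding SR_ideal_def
  proof (rule ring.genideal_minimal[OF mpoly_ring_ring J], intro subsetI CollectI conjI)
    fix g assume g: "g \<in> {mvar x * mvar y | x y. x \<in> carrier Q \<and> y \<in> carrier Q \<and> Upper Q {x, y} = {}} \<union>
      {mvar x * mvar y - mvar (x \<sqinter>\<^bsub>Q\<^esub> y) * (\<Sum>z \<in> minimal_upper_bounds Q x y. mvar z) | x y.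
         x \<in> carrier Q \<and> y \<in> carrier Q \<and> Upper Q {x, y} \<noteq> {}} \<union>
      {mvar \<bottom>\<^bsub>Q\<^esub> - 1 :: ('v \<Rightarrow>\<^sub>0 nat) \<Rightarrow>\<^sub>0 'k}"
    show "g \<in> carrier (mpoly_ring (carrier Q))" by (rule subsetD[OF SR_generators_closed g])
    show "eval_at y g = 0"
      using g by (elim UnE CollectE exE conjE singletonE) (simp_all only: 1 2 3)
  qed
  then show ?thesis using p by blast
qed

text \<open>Evaluate at the top of \<open>M\<close> and compare the coefficients at the weight of
  \<open>M\<close>. It is 1 for \<open>M\<close>. A monomial of \<open>p\<close> either vanishes or,
  by \<open>chain_monomial_eqI\<close>, has another weight. The form of the statement fits the
  stepwise construction of a basis in \<open>SR_dimension\<close>.\<close>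

lemma chain_monomial_independent:
  fixes p :: "('v \<Rightarrow>\<^sub>0 nat) \<Rightarrow>\<^sub>0 'k::field"
  assumes "M \<in> chain_monomials" "Poly_Mapping.keys p \<subseteq> chain_monomials" "M \<notin> Poly_Mapping.keys p"
  shows "Poly_Mapping.single M 1 - p \<notin> SR_ideal Q"
proof
  assume in_ideal: "Poly_Mapping.single M 1 - p \<in> SR_ideal Q"
  obtain y where y: "y \<in> carrier Q" "\<And>u. u \<in> Poly_Mapping.keys M \<Longrightarrow> u \<sqsubseteq>\<^bsub>Q\<^esub> y"
    using is_top_exists[OF assms(1)] by (auto simp: is_top_def)
  have "Poly_Mapping.lookup (eval_at y p) (weight \<sigma> M) = 0"
    unfolding eval_at_def linear_ext_def lookup_sum
  proof (rule sum.neutral, rule ballI)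
    fix N assume N: "N \<in> Poly_Mapping.keys p"
    have "N = M" if "Poly_Mapping.keys N \<subseteq> {x. x \<sqsubseteq>\<^bsub>Q\<^esub> y}" "weight \<sigma> N = weight \<sigma> M"
      by (rule chain_monomial_eqI[OF _ assms(1) y(1)]) (use that N assms y in auto)
    then show "Poly_Mapping.lookup (Poly_Mapping.single 0 (Poly_Mapping.lookup p N) *
       (if Poly_Mapping.keys N \<subseteq> {x. x \<sqsubseteq>\<^bsub>Q\<^esub> y} then Poly_Mapping.single (weight \<sigma> N) 1 else 0))
       (weight \<sigma> M) = 0"
      using N assms(3) by (auto simp: mult_single lookup_single when_def)
  qed
  moreover have "Poly_Mapping.lookup (eval_at y (Poly_Mapping.single M 1)) (weight \<sigma> M) = (1::'k)"
    using y(2) by (auto simp: eval_at_def mult_single)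
  moreover have "eval_at y (Poly_Mapping.single M 1) = eval_at y p"
    using eval_at_SR_ideal[OF y(1) in_ideal] by (simp add: eval_at_diff)
  ultimately show False by simp
qed

end

section \<open>Straightening and the Hilbert series\<close>

definition weighted_count :: "('v \<Rightarrow> nat) \<Rightarrow> ('v \<Rightarrow>\<^sub>0 nat) \<Rightarrow> nat" where
  "weighted_count g M = (\<Sum>x\<in>Poly_Mapping.keys M. Poly_Mapping.lookup M x * g x)"

lemma weighted_count_add [simp]:
  "weighted_count g (M + N) = weighted_count g M + weighted_count g N"
  unfolding weighted_count_def by (rule setsum_keys_plus_distrib) (auto simp: algebra_simps)

lemma weighted_count_single [simp]: "weighted_count g (Poly_Mapping.single x n) = n * g x"
  by (cases "n = 0") (auto simp: weighted_count_def)

text \<open>The difference of the two sides is 2 s t.\<close>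

lemma concave_exchange:
  fixes i s t B :: nat
  assumes "s > 0" "t > 0" "i + s + t \<le> B"
  shows "(B - i) * i + (B - (i + s + t)) * (i + s + t) <
    (B - (i + s)) * (i + s) + (B - (i + t)) * (i + t)"
proof -
  \<comment> \<open>Writing \<open>B\<close> as a sum eliminates all truncated subtractions.\<close>
  obtain k where B: "B = i + s + t + k" using assms(3) le_iff_add by blast
  have "s * t > 0" using assms by simp
  then show ?thesis by (simp add: B algebra_simps)
qed

lemma mono_add_eq: "Poly_Mapping.single (Poly_Mapping.single x 1 + M) 1 = mvar x * Poly_Mapping.single M 1"
  by (simp add: mvar_def mult_single)

section \<open>Reduction to chain monomials within a fixed degree\<close>

context labelled_simplicial_poset
begin

text \<open>The degree is built in because spanning is needed in every graded component
  separately.\<close>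

definition straightens :: "nat \<Rightarrow> (('v \<Rightarrow>\<^sub>0 nat) \<Rightarrow>\<^sub>0 'k::field) \<Rightarrow> bool" where
  "straightens d p \<longleftrightarrow> p \<in> carrier (mpoly_ring (carrier Q)) \<and>
     (\<exists>q. Poly_Mapping.keys q \<subseteq> {M \<in> chain_monomials. size (weight \<sigma> M) = d} \<and> p - q \<in> SR_ideal Q)"

lemma straightensI:
  "\<lbrakk>p \<in> carrier (mpoly_ring (carrier Q));
    Poly_Mapping.keys q \<subseteq> {M \<in> chain_monomials. size (weight \<sigma> M) = d}; p - q \<in> SR_ideal Q\<rbrakk>
   \<Longrightarrow> straightens d p"
  unfolding straightens_def by blast

lemma straightens_zero: "straightens d 0"
  using mpoly_ring_idealD(2)[OF SR_ideal_ideal] by (intro straightensI[of _ 0]) (auto simp: mem_mpoly_ring)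

lemma straightens_add:
  assumes "straightens d p" "straightens d q"
  shows "straightens d (p + q)"
proof -
  obtain p' q' where *: "p \<in> carrier (mpoly_ring (carrier Q))" "q \<in> carrier (mpoly_ring (carrier Q))"
    "Poly_Mapping.keys p' \<subseteq> {M \<in> chain_monomials. size (weight \<sigma> M) = d}" "p - p' \<in> SR_ideal Q"
    "Poly_Mapping.keys q' \<subseteq> {M \<in> chain_monomials. size (weight \<sigma> M) = d}" "q - q' \<in> SR_ideal Q"
    using assms unfolding straightens_def by blast
  show ?thesis
  proof (rule straightensI)
    show "p + q \<in> carrier (mpoly_ring (carrier Q))" using *(1,2) by (rule mpoly_ring_closed)
    show "Poly_Mapping.keys (p' + q') \<subseteq> {M \<in> chain_monomials. size (weight \<sigma> M) = d}"
      using Poly_Mapping.keys_add[of p' q'] *(3,5) by blast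
    show "(p + q) - (p' + q') \<in> SR_ideal Q"
      using mpoly_ring_idealD(3)[OF SR_ideal_ideal *(4,6)] by (simp add: algebra_simps)
  qed
qed

lemma straightens_sum:
  "(\<And>i. i \<in> A \<Longrightarrow> straightens d (p i)) \<Longrightarrow> straightens d (sum p A)"
  by (induction A rule: infinite_finite_induct) (auto simp: straightens_zero straightens_add)

lemma straightens_mconst:
  assumes "straightens d p"
  shows "straightens d (mconst c * p)"
proof -
  obtain p' where *: "p \<in> carrier (mpoly_ring (carrier Q))"
    "Poly_Mapping.keys p' \<subseteq> {M \<in> chain_monomials. size (weight \<sigma> M) = d}" "p - p' \<in> SR_ideal Q"
    using assms unfolding straightens_def by blast
  show ?thesis
  proof (rule straightensI)
    show "mconst c * p \<in> carrier (mpoly_ring (carrier Q))"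
      using mconst_closed *(1) by (rule mpoly_ring_closed)
    have "Poly_Mapping.keys (mconst c * p') \<subseteq> Poly_Mapping.keys p'"
      using keys_mult[of "mconst c" p'] by (auto simp: mconst_def split: if_splits)
    then show "Poly_Mapping.keys (mconst c * p') \<subseteq> {M \<in> chain_monomials. size (weight \<sigma> M) = d}"
      using *(2) by blast
    show "mconst c * p - mconst c * p' \<in> SR_ideal Q"
      using mpoly_ring_idealD(4)[OF SR_ideal_ideal *(3) mconst_closed[of c]] by (simp add: algebra_simps)
  qed
qed

lemma straightens_cong:
  assumes "straightens d q" "p - q \<in> SR_ideal Q" "p \<in> carrier (mpoly_ring (carrier Q))"
  shows "straightens d p"
proof -
  obtain q' where *:
    "Poly_Mapping.keys q' \<subseteq> {M \<in> chain_monomials. size (weight \<sigma> M) = d}" "q - q' \<in> SR_ideal Q"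
    using assms(1) unfolding straightens_def by blast
  show ?thesis
    using mpoly_ring_idealD(3)[OF SR_ideal_ideal assms(2) *(2)] by (intro straightensI[OF assms(3) *(1)]) simp
qed

lemma straightens_monomial:
  assumes "Poly_Mapping.keys M \<subseteq> carrier Q" "size (weight \<sigma> M) = d"
  shows "straightens d (Poly_Mapping.single M 1 :: ('v \<Rightarrow>\<^sub>0 nat) \<Rightarrow>\<^sub>0 'k::field)"
proof -
  \<comment> \<open>As a bound for all ranks, \<open>B\<close> keeps the subtraction in
    \<open>g\<close> from being truncated.\<close>
  define B where "B = Max ((card \<circ> \<sigma>) ` carrier Q)"
  have B: "card (\<sigma> x) \<le> B" if "x \<in> carrier Q" for x
    unfolding B_def using finite_carrier that by (intro Max_ge) auto
  \<comment> \<open>The product decreases when an incomparable pair is exchanged for its meet and a minimal upper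
    bound, the summand 1 when a factor \<open>\<bottom>\<close> is removed.\<close>
  define g where "g = (\<lambda>x. (B - card (\<sigma> x)) * card (\<sigma> x) + 1)"
  show ?thesis
    using assms
  proof (induction "weighted_count g M" arbitrary: M rule: less_induct)
    case less
    have M_closed: "(Poly_Mapping.single M 1 :: ('v \<Rightarrow>\<^sub>0 nat) \<Rightarrow>\<^sub>0 'k) \<in> carrier (mpoly_ring (carrier Q))"
      by (rule mono_closed[OF less.prems(1)])
    consider "M \<in> chain_monomials" | "\<bottom>\<^bsub>Q\<^esub> \<in> Poly_Mapping.keys M"
      | x y where "x \<in> Poly_Mapping.keys M" "y \<in> Poly_Mapping.keys M" "\<not> x \<sqsubseteq>\<^bsub>Q\<^esub> y" "\<not> y \<sqsubseteq>\<^bsub>Q\<^esub> x"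
      using less.prems(1) unfolding chain_monomials_def by blast
    then show ?case
    proof cases
      case 1
      then show ?thesis
        using M_closed less.prems(2) mpoly_ring_idealD(2)[OF SR_ideal_ideal]
        by (intro straightensI[of _ "Poly_Mapping.single M 1"]) auto
    next
      case 2
      obtain M' where M: "M = Poly_Mapping.single \<bottom>\<^bsub>Q\<^esub> 1 + M'" "Poly_Mapping.keys M' \<subseteq> Poly_Mapping.keys M"
        using in_keys_split[OF 2] .
      have M': "Poly_Mapping.keys M' \<subseteq> carrier Q" using M(2) less.prems(1) by blast
      have "straightens d (Poly_Mapping.single M' 1 :: ('v \<Rightarrow>\<^sub>0 nat) \<Rightarrow>\<^sub>0 'k)"
      proof (rule less.hyps[OF _ M'])
        show "weighted_count g M' < weighted_count g M" by (simp add: M(1) g_def)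
        show "size (weight \<sigma> M') = d" using less.prems(2) by (simp add: M(1) label_bottom)
      qed
      moreover have "Poly_Mapping.single M 1 - Poly_Mapping.single M' 1 \<in>
          (SR_ideal Q :: (('v \<Rightarrow>\<^sub>0 nat) \<Rightarrow>\<^sub>0 'k) set)"
        unfolding M(1) mono_add_eq
        using mpoly_ring_idealD(4)[OF SR_ideal_ideal SR_ideal_generators(3) mono_closed[OF M', of 1]]
        by (simp add: algebra_simps)
      ultimately show ?thesis using M_closed by (rule straightens_cong)
    next
      case 3
      obtain M1 where M1: "M = Poly_Mapping.single x 1 + M1" "Poly_Mapping.keys M1 \<subseteq> Poly_Mapping.keys M"
        using in_keys_split[OF 3(1)] .
      have xy: "x \<in> carrier Q" "y \<in> carrier Q" using 3(1,2) less.prems(1) by auto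
      \<comment> \<open>The two factors are distinct, so \<open>y\<close> is still present after one
        copy of \<open>x\<close> has been removed.\<close>
      have "y \<noteq> x" using 3(3) le_refl xy by blast
      then have y: "y \<in> Poly_Mapping.keys M1" using 3(2) by (auto simp: M1(1) keys_add_nat split: if_splits)
      obtain M2 where M2: "M1 = Poly_Mapping.single y 1 + M2" "Poly_Mapping.keys M2 \<subseteq> Poly_Mapping.keys M1"
        using in_keys_split[OF y] .
      have M2_carr: "Poly_Mapping.keys M2 \<subseteq> carrier Q" using order_trans[OF M2(2) order_trans[OF M1(2) less.prems(1)]] .
      let ?m2 = "Poly_Mapping.single M2 1 :: ('v \<Rightarrow>\<^sub>0 nat) \<Rightarrow>\<^sub>0 'k"
      have m2: "?m2 \<in> carrier (mpoly_ring (carrier Q))" by (rule mono_closed[OF M2_carr])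
      have M_eq: "Poly_Mapping.single M 1 = mvar x * mvar y * ?m2"
        by (simp only: M1(1) M2(1) mono_add_eq mult.assoc)
      show ?thesis
      proof (cases "Upper Q {x, y} = {}")
        case True
        have "Poly_Mapping.single M 1 - 0 \<in> (SR_ideal Q :: (('v \<Rightarrow>\<^sub>0 nat) \<Rightarrow>\<^sub>0 'k) set)"
          unfolding M_eq
          using mpoly_ring_idealD(4)[OF SR_ideal_ideal SR_ideal_generators(1)[OF xy True] m2]
          by (simp add: mult_ac)
        from straightens_cong[OF straightens_zero this M_closed] show ?thesis .
      next
        case False
        let ?w = "x \<sqinter>\<^bsub>Q\<^esub> y" and ?Z = "minimal_upper_bounds Q x y"
        let ?s = "\<Sum>z\<in>?Z. Poly_Mapping.single (Poly_Mapping.single ?w 1 + (Poly_Mapping.single z 1 + M2)) (1::'k)"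
        have "straightens d ?s"
        proof (rule straightens_sum)
          fix z assume "z \<in> ?Z"
          note z = minimal_upper_boundsD[OF this xy]
          have w_eq: "?w = \<rho> z (\<sigma> x \<inter> \<sigma> y)" by (rule meet_eq_face[OF z(1,2) xy z(3)])
          have sub: "\<sigma> x \<inter> \<sigma> y \<subseteq> \<sigma> z" by (auto simp: z(4))
          have w: "?w \<in> carrier Q" "\<sigma> ?w = \<sigma> x \<inter> \<sigma> y"
            unfolding w_eq by (rule face_closed[OF z(3) sub], rule label_face[OF z(3) sub])
          have fin: "finite (\<sigma> x)" "finite (\<sigma> y)" using finite_label xy by auto
          \<comment> \<open>The meet has rank i, the factors have ranks i + a and i + b, and each
            minimal upper bound has rank i + a + b: the pattern of \<open>concave_exchange\<close>.
            The same numbers show that the degree is preserved.\<close>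
          let ?i = "card (\<sigma> x \<inter> \<sigma> y)" and ?a = "card (\<sigma> x - \<sigma> y)" and ?b = "card (\<sigma> y - \<sigma> x)"
          have cx: "card (\<sigma> x) = ?i + ?a"
            using card_Int_Diff[OF fin(1)] .
          have cy: "card (\<sigma> y) = ?i + ?b"
            using card_Int_Diff[OF fin(2), of "\<sigma> x"] by (simp add: Int_commute)
          have cz: "card (\<sigma> z) = ?i + ?a + ?b"
            using card_Un_Int[OF fin] by (simp add: z(4) cx cy)
          \<comment> \<open>Incomparability of elements gives incomparability of labels only because
            \<open>z\<close> is a common upper bound.\<close>
          have "\<not> \<sigma> x \<subseteq> \<sigma> y" "\<not> \<sigma> y \<subseteq> \<sigma> x"
            using 3(3,4) le_if_label_subset z xy by blast+
          then have pos: "?a > 0" "?b > 0" using fin by (auto simp: card_gt_0_iff)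
          show "straightens d (Poly_Mapping.single
              (Poly_Mapping.single ?w 1 + (Poly_Mapping.single z 1 + M2)) (1::'k))"
          proof (rule less.hyps)
            show "weighted_count g (Poly_Mapping.single ?w 1 + (Poly_Mapping.single z 1 + M2))
                < weighted_count g M"
              using concave_exchange[OF pos, of ?i B] B[OF z(3)]
              by (simp add: M1(1) M2(1) g_def cx cy cz w(2))
            show "Poly_Mapping.keys (Poly_Mapping.single ?w 1 + (Poly_Mapping.single z 1 + M2)) \<subseteq> carrier Q"
              using w z M2_carr by (simp add: keys_add_nat)
            show "size (weight \<sigma> (Poly_Mapping.single ?w 1 + (Poly_Mapping.single z 1 + M2))) = d"
              using less.prems(2) by (simp add: M1(1) M2(1) cx cy cz w(2))
          qed
        qed
        moreover have "Poly_Mapping.single M 1 - ?s \<in> SR_ideal Q"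
        proof -
          have "?s = mvar ?w * (\<Sum>z\<in>?Z. mvar z) * ?m2"
            by (simp only: mono_add_eq sum_distrib_left sum_distrib_right mult.assoc)
          then have "Poly_Mapping.single M 1 - ?s =
              ?m2 * (mvar x * mvar y - mvar ?w * (\<Sum>z\<in>?Z. mvar z))"
            unfolding M_eq by (simp add: algebra_simps)
          then show ?thesis
            using mpoly_ring_idealD(4)[OF SR_ideal_ideal SR_ideal_generators(2)[OF xy False] m2] by simp
        qed
        ultimately show ?thesis using M_closed by (rule straightens_cong)
      qed
    qed
  qed
qed

lemma straightens_homogeneous:
  fixes p :: "('v \<Rightarrow>\<^sub>0 nat) \<Rightarrow>\<^sub>0 'k::field"
  assumes "p \<in> carrier (mpoly_ring (carrier Q))"
    "\<And>M. M \<in> Poly_Mapping.keys p \<Longrightarrow> size (weight \<sigma> M) = d"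
  shows "straightens d p"
proof -
  have "straightens d (\<Sum>M\<in>Poly_Mapping.keys p. mconst (Poly_Mapping.lookup p M) * Poly_Mapping.single M 1)"
    using assms by (intro straightens_sum straightens_mconst straightens_monomial) (auto simp: mem_mpoly_ring)
  also have "(\<Sum>M\<in>Poly_Mapping.keys p. mconst (Poly_Mapping.lookup p M) * Poly_Mapping.single M 1) = p"
    by (simp add: mconst_def mult_single flip: poly_mapping_sum_single)
  finally show ?thesis .
qed

section \<open>A basis of every graded component\<close>

abbreviation coset :: "(('v \<Rightarrow>\<^sub>0 nat) \<Rightarrow>\<^sub>0 'k::field) \<Rightarrow> (('v \<Rightarrow>\<^sub>0 nat) \<Rightarrow>\<^sub>0 'k) set" where
  "coset p \<equiv> SR_ideal Q +>\<^bsub>mpoly_ring (carrier Q)\<^esub> p"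

lemma chain_poly_closed:
  "Poly_Mapping.keys p \<subseteq> chain_monomials \<Longrightarrow> p \<in> carrier (mpoly_ring (carrier Q))"
  by (fastforce simp: mem_mpoly_ring chain_monomials_def)

text \<open>This is the spanning half: straightening changes a homogeneous polynomial neither in its
  class nor in its degree.\<close>

lemma SR_component_eq:
  "SR_component Q d = (coset ` {p. Poly_Mapping.keys p \<subseteq> {M \<in> chain_monomials. size (weight \<sigma> M) = d}}
     :: (('v \<Rightarrow>\<^sub>0 nat) \<Rightarrow>\<^sub>0 'k::field) set set)"
proof (intro equalityI subsetI)
  fix c :: "(('v \<Rightarrow>\<^sub>0 nat) \<Rightarrow>\<^sub>0 'k) set" assume "c \<in> SR_component Q d"
  then obtain p where p: "c = coset p" "p \<in> carrier (mpoly_ring (carrier Q))"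
    "\<And>M. M \<in> Poly_Mapping.keys p \<Longrightarrow> monomial_degree Q M = d"
    unfolding SR_component_def by blast
  have "straightens d p"
    by (rule straightens_homogeneous[OF p(2)]) (use p(2,3) monomial_degree_eq in \<open>force simp: mem_mpoly_ring\<close>)
  then obtain q where q: "Poly_Mapping.keys q \<subseteq> {M \<in> chain_monomials. size (weight \<sigma> M) = d}"
    "p - q \<in> SR_ideal Q" unfolding straightens_def by blast
  have "q \<in> carrier (mpoly_ring (carrier Q))" using q(1) by (intro chain_poly_closed) blast
  then have "c = coset q"
    using mpoly_ring_coset_eq_iff[OF SR_ideal_ideal p(2)] q(2) p(1) by simp
  then show "c \<in> coset ` {p. Poly_Mapping.keys p \<subseteq> {M \<in> chain_monomials. size (weight \<sigma> M) = d}}"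
    using q(1) by blast
next
  fix c :: "(('v \<Rightarrow>\<^sub>0 nat) \<Rightarrow>\<^sub>0 'k) set"
  assume "c \<in> coset ` {p. Poly_Mapping.keys p \<subseteq> {M \<in> chain_monomials. size (weight \<sigma> M) = d}}"
  then obtain q where q: "c = coset q"
    "Poly_Mapping.keys q \<subseteq> {M \<in> chain_monomials. size (weight \<sigma> M) = d}" by blast
  have carr: "q \<in> carrier (mpoly_ring (carrier Q))" using q(2) by (intro chain_poly_closed) blast
  then have "\<forall>M\<in>Poly_Mapping.keys q. monomial_degree Q M = d"
    using q(2) monomial_degree_eq by (fastforce simp: mem_mpoly_ring)
  then show "c \<in> SR_component Q d" unfolding SR_component_def using q(1) carr by blast
qed

text \<open>The predicate \<open>dimension\<close> grows by one whenever a vector outside the space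
  is adjoined, so the list is processed one chain monomial at a time, and
  \<open>chain_monomial_independent\<close> supplies the new vector.\<close>

lemma SR_dimension:
  fixes Ms :: "('v \<Rightarrow>\<^sub>0 nat) list"
  assumes "distinct Ms" "set Ms \<subseteq> chain_monomials"
  shows "ring.dimension (SR_ring Q :: (('v \<Rightarrow>\<^sub>0 nat) \<Rightarrow>\<^sub>0 'k::field) set ring) (length Ms) (SR_scalars Q)
    (coset ` {p. Poly_Mapping.keys p \<subseteq> set Ms})"
proof -
  let ?R = "mpoly_ring (carrier Q) :: (('v \<Rightarrow>\<^sub>0 nat) \<Rightarrow>\<^sub>0 'k) ring"
  let ?S = "SR_ring Q :: (('v \<Rightarrow>\<^sub>0 nat) \<Rightarrow>\<^sub>0 'k) set ring"
  interpret I: ideal "SR_ideal Q" ?R by (rule SR_ideal_ideal)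
  interpret S: ring ?S unfolding SR_ring_def by (rule I.quotient_is_ring)
  have hom: "coset \<in> ring_hom ?R ?S" unfolding SR_ring_def by (rule I.rcos_ring_hom)
  have coset_add: "coset p \<oplus>\<^bsub>?S\<^esub> coset q = coset (p + q)"
    and coset_mult: "coset p \<otimes>\<^bsub>?S\<^esub> coset q = coset (p * q)"
    if "p \<in> carrier ?R" "q \<in> carrier ?R" for p q
    using ring_hom_add[OF hom that] ring_hom_mult[OF hom that] by simp_all
  have coset_carr: "coset p \<in> carrier ?S" if "p \<in> carrier ?R" for p
    by (rule ring_hom_closed[OF hom that])
  have coset_zero: "coset 0 = \<zero>\<^bsub>?S\<^esub>"
    using ring_hom_zero[OF hom I.ring_axioms S.ring_axioms] by simp
  show ?thesis
    using assms
  proof (induction Ms)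
    case Nil
    have "coset ` {p. Poly_Mapping.keys p \<subseteq> set []} = {\<zero>\<^bsub>?S\<^esub>}" using coset_zero by auto
    then show ?case using S.zero_dim[of "SR_scalars Q"] by simp
  next
    case (Cons M Ms)
    let ?E = "coset ` {p. Poly_Mapping.keys p \<subseteq> set Ms} :: (('v \<Rightarrow>\<^sub>0 nat) \<Rightarrow>\<^sub>0 'k) set set"
    let ?v = "coset (Poly_Mapping.single M 1) :: (('v \<Rightarrow>\<^sub>0 nat) \<Rightarrow>\<^sub>0 'k) set"
    have M: "(Poly_Mapping.single M 1 :: ('v \<Rightarrow>\<^sub>0 nat) \<Rightarrow>\<^sub>0 'k) \<in> carrier ?R"
      using Cons.prems by (intro chain_poly_closed) simp
    have Ms: "p \<in> carrier ?R" if "Poly_Mapping.keys p \<subseteq> set Ms" for p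
      using Cons.prems that by (intro chain_poly_closed) auto
    have "?v \<notin> ?E"
    proof
      assume "?v \<in> ?E"
      then obtain p where p: "Poly_Mapping.keys p \<subseteq> set Ms" "?v = coset p" by blast
      then have "Poly_Mapping.single M 1 - p \<in> SR_ideal Q"
        using mpoly_ring_coset_eq_iff[OF SR_ideal_ideal M Ms] by blast
      then show False
        using chain_monomial_independent[of M p] Cons.prems p(1) by auto
    qed
    then have "S.dimension (Suc (length Ms)) (SR_scalars Q) (S.line_extension (SR_scalars Q) ?v ?E)"
      using Cons coset_carr[OF M] by (intro S.Suc_dim) auto
    moreover have "S.line_extension (SR_scalars Q) ?v ?E = coset ` {p. Poly_Mapping.keys p \<subseteq> set (M # Ms)}"
    proof (intro equalityI subsetI)
      fix u assume "u \<in> S.line_extension (SR_scalars Q) ?v ?E"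
      then obtain c p where p: "Poly_Mapping.keys p \<subseteq> set Ms"
        and u: "u = coset (mconst c) \<otimes>\<^bsub>?S\<^esub> ?v \<oplus>\<^bsub>?S\<^esub> coset p"
        unfolding S.line_extension_mem_iff SR_scalars_def by blast
      have "u = coset (mconst c * Poly_Mapping.single M 1 + p)"
        unfolding u using M Ms[OF p] by (simp add: coset_add coset_mult mconst_closed mpoly_ring_closed)
      moreover have "Poly_Mapping.keys (mconst c * Poly_Mapping.single M 1 + p) \<subseteq> set (M # Ms)"
        using Poly_Mapping.keys_add[of "mconst c * Poly_Mapping.single M 1" p] p
        by (auto simp: mconst_def mult_single split: if_splits)
      ultimately show "u \<in> coset ` {p. Poly_Mapping.keys p \<subseteq> set (M # Ms)}" by blast
    next
      fix u :: "(('v \<Rightarrow>\<^sub>0 nat) \<Rightarrow>\<^sub>0 'k) set"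
      assume "u \<in> coset ` {p. Poly_Mapping.keys p \<subseteq> set (M # Ms)}"
      then obtain q where q: "u = coset q" "Poly_Mapping.keys q \<subseteq> set (M # Ms)" by blast
      \<comment> \<open>Splitting off the term of \<open>M\<close> leaves a polynomial in the
        earlier monomials only.\<close>
      define p where "p = q - Poly_Mapping.single M (Poly_Mapping.lookup q M)"
      have "Poly_Mapping.keys p \<subseteq> Poly_Mapping.keys q - {M}"
        by (auto simp: p_def in_keys_iff lookup_minus lookup_single when_def split: if_splits)
      then have p: "Poly_Mapping.keys p \<subseteq> set Ms" using q(2) by auto
      have "q = mconst (Poly_Mapping.lookup q M) * Poly_Mapping.single M 1 + p"
        by (simp add: p_def mconst_def mult_single)
      then have "u = coset (mconst (Poly_Mapping.lookup q M)) \<otimes>\<^bsub>?S\<^esub> ?v \<oplus>\<^bsub>?S\<^esub> coset p"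
        unfolding q(1) using M Ms[OF p] by (simp add: coset_add coset_mult mconst_closed mpoly_ring_closed)
      then show "u \<in> S.line_extension (SR_scalars Q) ?v ?E"
        unfolding S.line_extension_mem_iff SR_scalars_def using p by blast
    qed
    ultimately show ?case by simp
  qed
qed

theorem has_SR_Hilbert_series_simplicial:
  "has_SR_Hilbert_series TYPE('k::field) Q (\<Sum>y\<in>carrier Q. (fps_X / (1 - fps_X)) ^ card (\<sigma> y))"
  unfolding has_SR_Hilbert_series_def
proof
  fix d
  let ?C = "{M \<in> chain_monomials. size (weight \<sigma> M) = d}"
  obtain Ms where Ms: "set Ms = ?C" "distinct Ms"
    using finite_distinct_list[OF finite_chain_monomials] by blast
  have "ring.dimension (SR_ring Q :: (('v \<Rightarrow>\<^sub>0 nat) \<Rightarrow>\<^sub>0 'k) set ring) (card ?C) (SR_scalars Q) (SR_component Q d)"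
    using SR_dimension[OF Ms(2)] distinct_card[OF Ms(2)] unfolding SR_component_eq Ms(1) by fastforce
  moreover have "fps_nth (\<Sum>y\<in>carrier Q. (fps_X / (1 - fps_X)) ^ card (\<sigma> y)) d = (of_nat (card ?C) :: rat)"
    unfolding fps_card_chain_monomials[symmetric] by simp
  ultimately show "\<exists>n. ring.dimension (SR_ring Q :: (('v \<Rightarrow>\<^sub>0 nat) \<Rightarrow>\<^sub>0 'k) set ring) n (SR_scalars Q)
      (SR_component Q d) \<and>
    fps_nth (\<Sum>y\<in>carrier Q. (fps_X / (1 - fps_X)) ^ card (\<sigma> y)) d = (of_nat n :: rat)"
    by blast
qed

end

section \<open>The independence poset\<close>

text \<open>Lagrange's theorem, with the index of the kernel supplied by the first isomorphism
  theorem.\<close>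

lemma card_eq_card_kernel_times:
  assumes "group G" "group H" "f \<in> epi G H"
  shows "card (carrier G) = card (kernel G H f) * card (carrier H)"
proof -
  interpret group_hom G H f
    using assms by (simp add: group_hom_def group_hom_axioms_def epi_def)
  have "f ` carrier G = carrier H" using assms(3) by (simp add: epi_def)
  then have "(\<lambda>X. the_elem (f ` X)) \<in> iso (G Mod kernel G H f) H"
    by (rule FactGroup_iso_set)
  then have "card (rcosets\<^bsub>G\<^esub> (kernel G H f)) = card (carrier H)"
    unfolding iso_def FactGroup_def by (auto dest: bij_betw_same_card)
  then show ?thesis
    using G.lagrange[OF subgroup_kernel] by (simp add: order_def mult.commute)
qed

section \<open>Restriction of group elements to smaller faces\<close>

lemma iter_proj_append:
  "iter_proj \<pi> S (xs @ ys) = iter_proj \<pi> S xs \<circ> iter_proj \<pi> (S \<union> set xs) ys"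
  by (induction xs arbitrary: S) (auto simp: comp_assoc)

text \<open>The elements below (T, h) turn out to be the pairs of a subset S of T and this
  restriction of h. The encoding copies \<open>proj_to_empty\<close>, which becomes the case of the
  empty face.\<close>

definition restrict_face ::
  "('e set \<Rightarrow> 'e \<Rightarrow> 'g \<Rightarrow> 'g) \<Rightarrow> 'e set \<Rightarrow> 'e set \<Rightarrow> 'g \<Rightarrow> 'g" where
  "restrict_face \<pi> S T = iter_proj \<pi> S (SOME ss. distinct ss \<and> set ss = T - S)"

lemma proj_to_empty_eq_restrict_face: "proj_to_empty \<pi> T = restrict_face \<pi> {} T"
  by (simp add: proj_to_empty_def restrict_face_def)

context surjective_group_structure
begin

lemma iter_proj_epi:
  assumes "B \<union> set ss \<in> \<Delta>" "B \<inter> set ss = {}" "distinct ss"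
  shows "iter_proj \<pi> B ss \<in> epi (G (B \<union> set ss)) (G B)"
  using assms
proof (induction ss arbitrary: B)
  case Nil
  then show ?case by (simp add: epi_def hom_def)
next
  case (Cons s ss)
  let ?f = "iter_proj \<pi> (insert s B) ss"
  have f: "?f \<in> epi (G (insert s B \<union> set ss)) (G (insert s B))"
    using Cons.prems by (intro Cons.IH) auto
  have p: "\<pi> B s \<in> epi (G (insert s B)) (G B)"
    using Cons.prems faces_subset by (intro proj_epi) (auto intro: subface)
  have "\<pi> B s \<circ> ?f \<in> hom (G (insert s B \<union> set ss)) (G B)"
    by (rule Group.hom_compose[of _ _ "G (insert s B)"]) (use f p in \<open>simp_all add: epi_def\<close>)
  moreover have "(\<pi> B s \<circ> ?f) ` carrier (G (insert s B \<union> set ss)) = carrier (G B)"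
    using f p unfolding epi_def image_comp[symmetric] by simp
  ultimately show ?case by (simp add: epi_def comp_def)
qed

text \<open>\<open>iter_proj_permute\<close> frees the map from the chosen enumeration; later
  arguments pick whichever enumeration is convenient.\<close>

lemma restrict_face_eq:
  assumes "S \<union> set ss \<in> \<Delta>" "S \<inter> set ss = {}" "distinct ss" "h \<in> carrier (G (S \<union> set ss))"
  shows "restrict_face \<pi> S (S \<union> set ss) h = iter_proj \<pi> S ss h"
proof -
  have "distinct (SOME ts. distinct ts \<and> set ts = S \<union> set ss - S) \<and>
    set (SOME ts. distinct ts \<and> set ts = S \<union> set ss - S) = S \<union> set ss - S"
    by (rule someI[of _ ss]) (use assms in auto)
  then show ?thesis
    unfolding restrict_face_def using assms by (intro iter_proj_permute[symmetric]) auto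
qed

lemma restrict_face_self: "\<lbrakk>T \<in> \<Delta>; h \<in> carrier (G T)\<rbrakk> \<Longrightarrow> restrict_face \<pi> T T h = h"
  using restrict_face_eq[of T "[]" h] by simp

lemma restrict_face_insert:
  "\<lbrakk>insert a S \<in> \<Delta>; a \<notin> S; h \<in> carrier (G (insert a S))\<rbrakk> \<Longrightarrow> restrict_face \<pi> S (insert a S) h = \<pi> S a h"
  using restrict_face_eq[of S "[a]" h] by simp

end

locale finite_surjective_group_structure = surjective_group_structure +
  assumes finite_ground: "finite E"
begin

lemma finite_face: "S \<in> \<Delta> \<Longrightarrow> finite S"
  using faces_subset finite_ground finite_subset by blast

lemma finite_complex: "finite \<Delta>"
  using faces_subset finite_ground finite_subset by blast

lemma enumerate_difference:
  assumes "T \<in> \<Delta>" "S \<subseteq> T"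
  obtains ss where "distinct ss" "S \<inter> set ss = {}" "T = S \<union> set ss"
proof -
  obtain ss where "set ss = T - S" "distinct ss"
    using finite_distinct_list[of "T - S"] finite_face[OF assms(1)] by auto
  then show ?thesis using that assms(2) by (metis Diff_disjoint Diff_partition)
qed

lemma restrict_face_closed:
  assumes "T \<in> \<Delta>" "S \<subseteq> T" "h \<in> carrier (G T)"
  shows "restrict_face \<pi> S T h \<in> carrier (G S)"
proof -
  obtain ss where ss: "distinct ss" "S \<inter> set ss = {}" "T = S \<union> set ss"
    using enumerate_difference[OF assms(1,2)] .
  then show ?thesis using assms by (simp add: restrict_face_eq iter_proj_closed)
qed

text \<open>Functoriality: an enumeration of \<open>S - R\<close> followed by one of
  \<open>T - S\<close> enumerates \<open>T - R\<close>.\<close>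

lemma restrict_face_trans:
  assumes "T \<in> \<Delta>" "S \<subseteq> T" "R \<subseteq> S" "h \<in> carrier (G T)"
  shows "restrict_face \<pi> R S (restrict_face \<pi> S T h) = restrict_face \<pi> R T h"
proof -
  have S: "S \<in> \<Delta>" using subface assms by blast
  obtain ss where ss: "distinct ss" "S \<inter> set ss = {}" "T = S \<union> set ss"
    using enumerate_difference[OF assms(1,2)] .
  obtain rs where rs: "distinct rs" "R \<inter> set rs = {}" "S = R \<union> set rs"
    using enumerate_difference[OF S assms(3)] .
  have T: "T = R \<union> set (rs @ ss)" using ss(3) rs(3) by auto
  have "restrict_face \<pi> R T h = iter_proj \<pi> R (rs @ ss) h"
    unfolding T by (rule restrict_face_eq) (use assms ss rs T in auto)
  moreover have "restrict_face \<pi> S T h = iter_proj \<pi> S ss h"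
    unfolding ss(3) by (rule restrict_face_eq) (use assms ss in auto)
  moreover have "restrict_face \<pi> R S (iter_proj \<pi> S ss h) = iter_proj \<pi> R rs (iter_proj \<pi> S ss h)"
    unfolding rs(3)
    by (rule restrict_face_eq) (use assms S ss rs iter_proj_closed[of S ss h] in auto)
  ultimately show ?thesis by (simp add: iter_proj_append flip: rs(3))
qed

lemma proj_to_empty_epi:
  assumes "S \<in> \<Delta>"
  shows "proj_to_empty \<pi> S \<in> epi (G S) (G {})"
proof -
  obtain ss where ss: "distinct ss \<and> set ss = S"
    using finite_distinct_list[OF finite_face[OF assms]] by blast
  \<comment> \<open>Working with the chosen enumeration itself avoids transferring
    \<open>epi\<close> between maps known to agree only on the carrier.\<close>
  define ts where "ts = (SOME ss. distinct ss \<and> set ss = S)"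
  have "distinct ts \<and> set ts = S" unfolding ts_def by (rule someI[of _ ss]) (rule ss)
  then have "iter_proj \<pi> {} ts \<in> epi (G S) (G {})"
    using iter_proj_epi[of "{}" ts] assms by auto
  then show ?thesis by (simp add: proj_to_empty_def ts_def)
qed

lemma card_torsion_free_part:
  assumes "S \<in> \<Delta>"
  shows "card (carrier (G S)) = card (carrier (torsion_free_part G \<pi> S)) * card (carrier (G {}))"
  using card_eq_card_kernel_times[OF _ _ proj_to_empty_epi[OF assms]]
    comm_group.axioms(2)[OF abelian[OF assms]] comm_group.axioms(2)[OF abelian[OF empty_face]]
  by (simp add: torsion_free_part_def)

section \<open>The independence poset of the torsion-free part\<close>

abbreviation tf_poset :: "('a set \<times> 'b) gorder" where
  "tf_poset \<equiv> ind_poset \<Delta> (torsion_free_part G \<pi>) \<pi>"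

lemma mem_torsion_free_part:
  "h \<in> carrier (torsion_free_part G \<pi> S) \<longleftrightarrow>
     h \<in> carrier (G S) \<and> restrict_face \<pi> {} S h = \<one>\<^bsub>G {}\<^esub>"
  by (auto simp: torsion_free_part_def kernel_def proj_to_empty_eq_restrict_face)

lemma mem_tf_poset:
  "(S, h) \<in> carrier tf_poset \<longleftrightarrow> S \<in> \<Delta> \<and> h \<in> carrier (torsion_free_part G \<pi> S)"
  by (simp add: ind_poset_def)

text \<open>By functoriality an element and its restriction have the same image at the empty
  face.\<close>

lemma restrict_face_torsion_free_part:
  assumes "T \<in> \<Delta>" "S \<subseteq> T" "h \<in> carrier (torsion_free_part G \<pi> T)"
  shows "restrict_face \<pi> S T h \<in> carrier (torsion_free_part G \<pi> S)"
  using assms restrict_face_closed[OF assms(1,2)] restrict_face_trans[OF assms(1,2), of "{}" h]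
  by (simp add: mem_torsion_free_part)

text \<open>A cover restricts by one ground element, and functoriality composes the covers of the
  reflexive transitive closure into one restriction.\<close>

lemma tf_poset_leD:
  assumes "(S, g) \<sqsubseteq>\<^bsub>tf_poset\<^esub> (T, h)" "(S, g) \<in> carrier tf_poset"
  shows "S \<subseteq> T \<and> g = restrict_face \<pi> S T h"
proof -
  have "(ind_covers \<Delta> (torsion_free_part G \<pi>) \<pi>)\<^sup>*\<^sup>* (S, g) (T, h)"
    using assms(1) by (simp add: ind_poset_def)
  then have "(T, h) \<in> carrier tf_poset \<and> S \<subseteq> T \<and> g = restrict_face \<pi> S T h"
  proof (induction "(T, h)" arbitrary: T h rule: rtranclp_induct)
    case base
    then show ?case using assms(2) by (auto simp: restrict_face_self mem_tf_poset mem_torsion_free_part)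
  next
    case (step y)
    then obtain U a where U: "y = (U, \<pi> U a h)" "T = insert a U" "a \<notin> U" "U \<in> \<Delta>" "insert a U \<in> \<Delta>"
      "h \<in> carrier (torsion_free_part G \<pi> (insert a U))"
      by (auto simp: ind_covers_def)
    have IH: "S \<subseteq> U" "g = restrict_face \<pi> S U (\<pi> U a h)" using step.hyps(3) U(1) by auto
    have h: "h \<in> carrier (G (insert a U))" using U(6) by (simp add: mem_torsion_free_part)
    have "g = restrict_face \<pi> S (insert a U) h"
      using restrict_face_trans[OF U(5) subset_insertI IH(1) h] IH(2) restrict_face_insert[OF U(5,3) h] by simp
    then show ?case using U IH(1) by (auto simp: mem_tf_poset)
  qed
  then show ?thesis by simp
qed

text \<open>The elements of \<open>T - S\<close> are added to \<open>S\<close> one by one; each step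
  prepends one cover at the lower end of the chain.\<close>

lemma tf_poset_leI:
  assumes "(T, h) \<in> carrier tf_poset" "S \<subseteq> T"
  shows "(S, restrict_face \<pi> S T h) \<sqsubseteq>\<^bsub>tf_poset\<^esub> (T, h)"
proof -
  have T: "T \<in> \<Delta>" "h \<in> carrier (torsion_free_part G \<pi> T)" using assms(1) by (auto simp: mem_tf_poset)
  have hG: "h \<in> carrier (G T)" using T(2) by (simp add: mem_torsion_free_part)
  obtain ss where ss: "distinct ss" "S \<inter> set ss = {}" "T = S \<union> set ss"
    using enumerate_difference[OF T(1) assms(2)] .
  then have "(ind_covers \<Delta> (torsion_free_part G \<pi>) \<pi>)\<^sup>*\<^sup>* (S, restrict_face \<pi> S T h) (T, h)"
  proof (induction ss arbitrary: S)
    case Nil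
    then show ?case using restrict_face_self[OF T(1) hG] by simp
  next
    case (Cons s ss)
    let ?S = "insert s S" and ?w = "restrict_face \<pi> (insert s S) T h"
    have sub: "?S \<subseteq> T" "S \<subseteq> T" "s \<notin> S" using Cons.prems by auto
    have \<Delta>: "?S \<in> \<Delta>" "S \<in> \<Delta>" using subface[OF T(1)] sub by auto
    have "(ind_covers \<Delta> (torsion_free_part G \<pi>) \<pi>)\<^sup>*\<^sup>* (?S, ?w) (T, h)"
      using Cons.prems by (intro Cons.IH) auto
    moreover have w: "?w \<in> carrier (torsion_free_part G \<pi> ?S)"
      by (rule restrict_face_torsion_free_part[OF T(1) sub(1) T(2)])
    have wG: "?w \<in> carrier (G ?S)" using w by (simp add: mem_torsion_free_part)
    have "\<pi> S s ?w = restrict_face \<pi> S T h"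
      using restrict_face_insert[OF \<Delta>(1) sub(3) wG] restrict_face_trans[OF T(1) sub(1) subset_insertI hG]
      by simp
    then have "ind_covers \<Delta> (torsion_free_part G \<pi>) \<pi> (S, restrict_face \<pi> S T h) (?S, ?w)"
      using \<Delta> sub w restrict_face_torsion_free_part[OF T(1) sub(2) T(2)]
      unfolding ind_covers_def by blast
    ultimately show ?case by (rule converse_rtranclp_into_rtranclp[rotated])
  qed
  then show ?thesis by (simp add: ind_poset_def)
qed

lemma finite_tf_poset: "finite (carrier tf_poset)"
proof -
  have "carrier tf_poset = (SIGMA S:\<Delta>. carrier (torsion_free_part G \<pi> S))"
    by (auto simp: ind_poset_def)
  moreover have "finite (carrier (torsion_free_part G \<pi> S))" if "S \<in> \<Delta>" for S
    by (rule finite_subset[OF _ finite_group[OF that]]) (auto simp: mem_torsion_free_part)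
  ultimately show ?thesis using finite_complex by auto
qed

lemma tf_poset_simplicial:
  "labelled_simplicial_poset tf_poset fst (\<lambda>(T, h) S. (S, restrict_face \<pi> S T h))"
proof (unfold_locales, goal_cases)
  case 1
  show ?case by (rule finite_tf_poset)
next
  case 2
  interpret group "G {}" using comm_group.axioms(2)[OF abelian[OF empty_face]] .
  have "({}, \<one>\<^bsub>G {}\<^esub>) \<in> carrier tf_poset"
    using empty_face by (auto simp: mem_tf_poset mem_torsion_free_part restrict_face_self)
  then show ?case by blast
next
  case (3 x)
  then show ?case by (cases x) (auto simp: mem_tf_poset finite_face)
next
  case (4 x A)
  then show ?case by (cases x) (auto simp: mem_tf_poset intro: subface restrict_face_torsion_free_part)
next
  case (5 x A)
  then show ?case by (cases x) auto
next
  case (6 x A B)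
  then show ?case
    by (cases x) (auto simp: mem_tf_poset mem_torsion_free_part intro: restrict_face_trans)
next
  case (7 x)
  then show ?case by (cases x) (auto simp: mem_tf_poset mem_torsion_free_part restrict_face_self)
next
  case (8 x y)
  obtain S g T h where "x = (S, g)" "y = (T, h)" by (metis surj_pair)
  then show ?case using 8 tf_poset_leD[of S g T h] tf_poset_leI[of T h S] by auto
next
  \<comment> \<open>Restriction from the empty face to itself is the identity, so its kernel is
    trivial and the minimum is unique. In the poset of \<open>G\<close> every element of the group
    at the empty face gives a minimal element.\<close>
  case (9 x y)
  then show ?case
    by (cases x; cases y) (auto simp: mem_tf_poset mem_torsion_free_part restrict_face_self empty_face)
qed

lemma tf_poset_eq_if_torsion_free:
  assumes "torsion_free G"
  shows "tf_poset = ind_poset \<Delta> G \<pi>"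
proof -
  interpret group "G {}" using comm_group.axioms(2)[OF abelian[OF empty_face]] .
  have "carrier (G {}) = {\<one>\<^bsub>G {}\<^esub>}"
    using assms one_closed by (metis card_1_singletonE singletonD torsion_free_def)
  then have "h \<in> carrier (torsion_free_part G \<pi> S) \<longleftrightarrow> h \<in> carrier (G S)" if "S \<in> \<Delta>" for S h
    using restrict_face_closed[OF that, of "{}" h] by (auto simp: mem_torsion_free_part)
  then have "carrier (torsion_free_part G \<pi> S) = carrier (G S)" if "S \<in> \<Delta>" for S
    using that by blast
  \<comment> \<open>The two structures are compared on faces only, which is all that the poset
    depends on.\<close>
  then have "{(S, g). S \<in> \<Delta> \<and> g \<in> carrier (torsion_free_part G \<pi> S)} = {(S, g). S \<in> \<Delta> \<and> g \<in> carrier (G S)}"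
    "ind_covers \<Delta> (torsion_free_part G \<pi>) \<pi> = ind_covers \<Delta> G \<pi>"
    by (auto simp: ind_covers_def fun_eq_iff)
  then show ?thesis by (simp add: ind_poset_def)
qed

end

section \<open>The h-vector\<close>

lemma fps_one_minus_X_power:
  "(1 - fps_X :: 'a::comm_ring_1 fps) ^ n = (\<Sum>k\<le>n. fps_const (of_nat (n choose k) * (- 1) ^ k) * fps_X ^ k)"
proof -
  have "(1 - fps_X :: 'a fps) ^ n = (- fps_X + 1) ^ n" by simp
  also have "\<dots> = (\<Sum>k\<le>n. of_nat (n choose k) * (- fps_X) ^ k * 1 ^ (n - k))"
    by (rule binomial_ring)
  also have "\<dots> = (\<Sum>k\<le>n. fps_const (of_nat (n choose k) * (- 1) ^ k) * fps_X ^ k)"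
    by (intro sum.cong refl)
       (simp add: power_minus[of fps_X] fps_of_nat[symmetric] fps_const_power[symmetric]
         fps_const_mult[symmetric] fps_const_neg[symmetric] del: fps_const_mult fps_const_power fps_const_neg)
  finally show ?thesis .
qed

text \<open>The binomial theorem for (t - 1)^(r - j). Where the exponent of -1 is truncated, the
  binomial coefficient vanishes.\<close>

lemma coeff_pcompose_f_poly:
  "Polynomial.coeff (pcompose (f_poly r P) [:- 1, 1:]) i =
     (\<Sum>j\<le>r. int (f_vector P j) * (int ((r - j) choose i) * (- 1) ^ (r - j - i)))"
proof -
  have "pcompose (Polynomial.monom c n) p = Polynomial.smult c (p ^ n)" for c :: int and n p
    by (induction n) (simp_all add: monom_0 monom_Suc pcompose_pCons)
  moreover have "Polynomial.coeff ([:- 1, 1:] ^ n) i = int (n choose i) * (- 1) ^ (n - i)" for n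
    by (cases "i \<le> n") (simp_all add: coeff_linear_poly_power coeff_eq_0 degree_linear_power)
  ultimately show ?thesis
    by (simp add: f_poly_def pcompose_sum coeff_sum)
qed

lemma fps_const_sum: "fps_const (sum f A) = (\<Sum>i\<in>A. fps_const (f i))"
  by (induction A rule: infinite_finite_induct) (simp_all flip: fps_const_add)

text \<open>The left side is the reversed polynomial t^r f(1/t - 1), whose j-th term is f_j t^j (1 -
  t)^(r - j). The proof carries out this reversal on coefficients.\<close>

lemma h_vector_fps:
  "(\<Sum>i\<le>r. fps_const (of_int (h_vector r P i)) * fps_X ^ i :: 'a::comm_ring_1 fps) =
     (\<Sum>j\<le>r. of_nat (f_vector P j) * (fps_X ^ j * (1 - fps_X) ^ (r - j)))"
proof -
  let ?c = "\<lambda>j i. fps_const (of_nat (f_vector P j) *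
    (of_nat ((r - j) choose (r - i)) * (- 1) ^ (r - j - (r - i)))) * fps_X ^ i :: 'a fps"
  have "(\<Sum>i\<le>r. fps_const (of_int (h_vector r P i)) * fps_X ^ i :: 'a fps) = (\<Sum>i\<le>r. \<Sum>j\<le>r. ?c j i)"
    by (simp add: h_vector_def coeff_pcompose_f_poly sum_distrib_right fps_const_sum)
  also have "\<dots> = (\<Sum>j\<le>r. \<Sum>i\<le>r. ?c j i)" by (rule sum.swap)
  also have "\<dots> = (\<Sum>j\<le>r. of_nat (f_vector P j) * (fps_X ^ j * (1 - fps_X) ^ (r - j)))"
  proof (rule sum.cong[OF refl])
    fix j assume "j \<in> {..r}"
    then have j: "j \<le> r" by simp
    \<comment> \<open>The terms below \<open>j\<close> vanish because \<open>r - i\<close> exceeds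
      \<open>r - j\<close>; the others are reindexed by i = j + k.\<close>
    have "(r - j) choose (r - i) = 0" if "i < j" for i
      by (rule binomial_eq_0) (use j that in linarith)
    then have "(\<Sum>i\<le>r. ?c j i) = (\<Sum>i\<in>{j..r}. ?c j i)"
      by (intro sum.mono_neutral_right) (auto simp: not_le binomial_eq_0)
    also have "\<dots> = (\<Sum>k\<le>r - j. ?c j (j + k))"
      by (rule sum.reindex_bij_witness[of _ "\<lambda>k. j + k" "\<lambda>i. i - j"]) (use j in auto)
    also have "\<dots> = (\<Sum>k\<le>r - j. of_nat (f_vector P j) *
        (fps_X ^ j * (fps_const (of_nat ((r - j) choose k) * (- 1) ^ k) * fps_X ^ k)))"
    proof (rule sum.cong[OF refl])
      fix k assume "k \<in> {..r - j}"
      then have k: "k \<le> r - j" by simp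
      have "(r - j) choose (r - (j + k)) = (r - j) choose k"
        using binomial_symmetric[OF k] by (simp add: diff_diff_eq)
      moreover have "r - j - (r - (j + k)) = k" using k j by simp
      ultimately show "?c j (j + k) = of_nat (f_vector P j) *
        (fps_X ^ j * (fps_const (of_nat ((r - j) choose k) * (- 1) ^ k) * fps_X ^ k))"
        by (simp add: power_add fps_of_nat[symmetric] fps_const_mult[symmetric] mult_ac del: fps_const_mult)
    qed
    finally show "(\<Sum>i\<le>r. ?c j i) = of_nat (f_vector P j) * (fps_X ^ j * (1 - fps_X) ^ (r - j))"
      by (simp add: fps_one_minus_X_power sum_distrib_left)
  qed
  finally show ?thesis .
qed

text \<open>The numerator is exhibited as a multiple of the denominator by writing t as t / (1 - t)
  times 1 - t, and then the denominator cancels.\<close>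

lemma h_vector_fps_divide:
  "(\<Sum>i\<le>r. fps_const (of_int (h_vector r P i)) * fps_X ^ i) / (1 - fps_X) ^ r =
     (\<Sum>j\<le>r. of_nat (f_vector P j) * (fps_X / (1 - fps_X) :: 'a::field fps) ^ j)"
proof -
  have nz: "1 - fps_X \<noteq> (0 :: 'a fps)"
    by (auto simp: fps_eq_iff intro!: exI[of _ 0])
  define \<phi> :: "'a fps" where "\<phi> = fps_X / (1 - fps_X)"
  have \<phi>: "fps_X = \<phi> * (1 - fps_X)"
    unfolding \<phi>_def fps_X_over_one_minus_X by (rule fps_ext) (auto simp: algebra_simps)
  have shift: "fps_X ^ j * (1 - fps_X) ^ (r - j) = \<phi> ^ j * (1 - fps_X) ^ r" if "j \<le> r" for j
  proof -
    have "fps_X ^ j = \<phi> ^ j * (1 - fps_X) ^ j"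
      by (subst \<phi>) (rule power_mult_distrib)
    moreover have "(1 - fps_X) ^ j * (1 - fps_X) ^ (r - j) = (1 - fps_X :: 'a fps) ^ r"
      using that by (simp flip: power_add)
    ultimately show ?thesis by (simp add: mult.assoc)
  qed
  have eq: "(\<Sum>i\<le>r. fps_const (of_int (h_vector r P i)) * fps_X ^ i) =
      (\<Sum>j\<le>r. of_nat (f_vector P j) * \<phi> ^ j) * (1 - fps_X) ^ r"
    unfolding h_vector_fps sum_distrib_right mult.assoc
    by (intro sum.cong refl arg_cong[where f = "(*) _"] shift) (simp only: atMost_iff)
  show ?thesis
    unfolding eq nonzero_mult_div_cancel_right[OF power_not_zero[OF nz]] \<phi>_def ..
qed

section \<open>Comparison of face numbers and group orders\<close>

context finite_surjective_group_structure
begin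

lemma f_vector_sum:
  "(\<Sum>j\<le>complex_rank \<Delta>. of_nat (f_vector (ind_poset \<Delta> G \<pi>) j) * \<phi> ^ j) =
     (\<Sum>S\<in>\<Delta>. of_nat (card (carrier (G S))) * \<phi> ^ card S :: 'c::comm_semiring_1)"
proof -
  let ?P = "ind_poset \<Delta> G \<pi>"
  have carr: "carrier ?P = (SIGMA S:\<Delta>. carrier (G S))" by (auto simp: ind_poset_def)
  have fin: "finite (carrier ?P)" unfolding carr using finite_complex finite_group by auto
  \<comment> \<open>No face exceeds the rank, so the sum over ranks up to
    \<open>complex_rank \<Delta>\<close> covers the whole poset.\<close>
  have rank: "card S \<le> complex_rank \<Delta>" if "S \<in> \<Delta>" for S
    unfolding complex_rank_def using that finite_complex by (intro Max_ge) auto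
  have "(\<Sum>j\<le>complex_rank \<Delta>. of_nat (f_vector ?P j) * \<phi> ^ j) =
      (\<Sum>j\<le>complex_rank \<Delta>. \<Sum>x | x \<in> carrier ?P \<and> ind_rank x = j. \<phi> ^ ind_rank x)"
    by (simp add: f_vector_def)
  also have "\<dots> = (\<Sum>x\<in>carrier ?P. \<phi> ^ ind_rank x)"
    using fin rank by (intro sum.group) (auto simp: carr ind_rank_def)
  also have "\<dots> = (\<Sum>S\<in>\<Delta>. \<Sum>g\<in>carrier (G S). \<phi> ^ card S)"
    unfolding carr using finite_complex finite_group
    by (subst sum.Sigma) (auto simp: ind_rank_def split_def)
  finally show ?thesis by simp
qed

theorem torsion_free_part_Hilbert_series:
  assumes "r = complex_rank \<Delta>"
  shows "has_SR_Hilbert_series TYPE('k::field) tf_poset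
    (fps_const (1 / of_nat (card (carrier (G {})))) *
      ((\<Sum>i\<le>r. fps_const (of_int (h_vector r (ind_poset \<Delta> G \<pi>) i)) * fps_X ^ i) / (1 - fps_X) ^ r))"
proof -
  interpret Q: labelled_simplicial_poset tf_poset fst "\<lambda>(T, h) S. (S, restrict_face \<pi> S T h)"
    by (rule tf_poset_simplicial)
  let ?n = "card (carrier (G {}))" and ?\<phi> = "fps_X / (1 - fps_X) :: rat fps"
  let ?K = "\<lambda>S. carrier (torsion_free_part G \<pi> S)"
  have "\<one>\<^bsub>G {}\<^esub> \<in> carrier (G {})"
    using comm_group.axioms(2)[OF abelian[OF empty_face]] by (simp add: group_def monoid.one_closed)
  then have n: "?n > 0" using finite_group[OF empty_face] by (auto simp: card_gt_0_iff)
  have carr: "carrier tf_poset = (SIGMA S:\<Delta>. ?K S)" by (auto simp: ind_poset_def)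
  have finK: "finite (?K S)" if "S \<in> \<Delta>" for S
    by (rule finite_subset[OF _ finite_group[OF that]]) (auto simp: mem_torsion_free_part)
  have "(\<Sum>y\<in>carrier tf_poset. ?\<phi> ^ card (fst y)) = (\<Sum>S\<in>\<Delta>. \<Sum>g\<in>?K S. ?\<phi> ^ card S)"
    unfolding carr using finite_complex finK by (subst sum.Sigma) (auto simp: split_def)
  also have "\<dots> = (\<Sum>S\<in>\<Delta>. fps_const (1 / of_nat ?n) * (of_nat (card (carrier (G S))) * ?\<phi> ^ card S))"
  proof (rule sum.cong[OF refl])
    fix S assume "S \<in> \<Delta>"
    \<comment> \<open>The order of the group at \<open>S\<close> is \<open>?n\<close> times that of
      the kernel, and \<open>?n\<close> is positive, so it cancels over the rationals.\<close>
    have "fps_const (1 / of_nat ?n) * of_nat (card (carrier (G S))) = (of_nat (card (?K S)) :: rat fps)"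
      unfolding card_torsion_free_part[OF \<open>S \<in> \<Delta>\<close>] using n by (simp flip: fps_of_nat)
    then show "(\<Sum>g\<in>?K S. ?\<phi> ^ card S) =
        fps_const (1 / of_nat ?n) * (of_nat (card (carrier (G S))) * ?\<phi> ^ card S)"
      by (simp flip: mult.assoc)
  qed
  also have "\<dots> = fps_const (1 / of_nat ?n) *
      ((\<Sum>i\<le>r. fps_const (of_int (h_vector r (ind_poset \<Delta> G \<pi>) i)) * fps_X ^ i) / (1 - fps_X) ^ r)"
    unfolding h_vector_fps_divide assms f_vector_sum sum_distrib_left ..
  finally show ?thesis using Q.has_SR_Hilbert_series_simplicial by simp
qed

end

theorem theorem3p3:
  fixes E :: "'e set" and \<Delta> :: "'e set set"
    and G :: "'e set \<Rightarrow> 'g monoid" and \<pi> :: "'e set \<Rightarrow> 'e \<Rightarrow> 'g \<Rightarrow> 'g" and r :: nat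
  assumes "finite E"
    and "surjective_group_structure E \<Delta> G \<pi>"
    and "r = complex_rank \<Delta>"
  shows "(torsion_free G \<longrightarrow>
      has_SR_Hilbert_series TYPE('k::field) (ind_poset \<Delta> G \<pi>)
        ((\<Sum>i\<le>r. fps_const (of_int (h_vector r (ind_poset \<Delta> G \<pi>) i)) * fps_X ^ i) / (1 - fps_X) ^ r)) \<and>
    has_SR_Hilbert_series TYPE('k) (ind_poset \<Delta> (torsion_free_part G \<pi>) \<pi>)
      (fps_const (1 / of_nat (card (carrier (G {})))) *
        ((\<Sum>i\<le>r. fps_const (of_int (h_vector r (ind_poset \<Delta> G \<pi>) i)) * fps_X ^ i) / (1 - fps_X) ^ r))"
proof -
  interpret finite_surjective_group_structure E \<Delta> G \<pi>
    using assms by (simp add: finite_surjective_group_structure_def finite_surjective_group_structure_axioms_def)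
  note general = torsion_free_part_Hilbert_series[OF assms(3)]
  show ?thesis
  proof (intro conjI impI)
    assume "torsion_free G"
    then show "has_SR_Hilbert_series TYPE('k) (ind_poset \<Delta> G \<pi>)
        ((\<Sum>i\<le>r. fps_const (of_int (h_vector r (ind_poset \<Delta> G \<pi>) i)) * fps_X ^ i) / (1 - fps_X) ^ r)"
      \<comment> \<open>Now the group at the empty face has order 1, so the scalar factor is 1, and
        the two posets coincide.\<close>
      using general tf_poset_eq_if_torsion_free by (simp add: torsion_free_def)
  qed (rule general)
qed

end
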